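(* Let $K$ be a field, let $G$ be a finite connected simple graph on the vertex set $[n]=\{1,\ldots,n\}$ with at least two edges, and let $I_G\subset S=K[x_1,\ldots,x_n]$ be its edge ideal. Then $\operatorname{dstab}(I_G)<\ell(I_G)$. In particular, $\operatorname{dstab}(I_G)<n$.
   Context: Let $S=K[x_1,\ldots,x_n]$ be the polynomial ring over a field $K$ with graded maximal ideal $\mathfrak m=(x_1,\ldots,x_n)$. For a finite simple graph $G$ on $[n]$ with edge set $E(G)$, the edge ideal is the ideal $I_G\subset S$ generated by the monomials $x_ix_j$ with $\{i,j\}\in E(G)$. For a graded ideal $I\subset S$, $\operatorname{depth} S/I^k$ is constant for all $k\gg 0$ (Brodmann), and one defines $$\operatorname{dstab}(I)=\min\{k\geq 1 : \operatorname{depth} S/I^k=\operatorname{depth} S/I^l \text{ for all } l\geq k\}.$$ Here depth is taken with respect to $\mathfrak m$. The analytic spread $\ell(I)$ of $I$ is the Krull dimension of $\mathcal R(I)/\mathfrak m\mathcal R(I)$, where $\mathcal R(I)=\bigoplus_{k\geq 0}I^kt^k\subset S[t]$ is the Rees ring of $I$. *)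

theory Defs
  imports
    "HOL-Algebra.Algebra"
    "HOL-Algebra.Algebraic_Closure_Type"
    "HOL-Library.Cardinality"
    "HOL-Library.Poly_Mapping"
    "HOL-Library.Extended_Nat"
begin

section \<open>Commutative algebra\<close>

subsection \<open>Krull dimension\<close>

text \<open>The list \<open>P\<^sub>0, \<dots>, P\<^sub>d\<close> of primes has length \<open>d + 1\<close>. The zero ring gets
  dimension \<open>0\<close>.\<close>

definition krull_dim :: "('a, 'b) ring_scheme \<Rightarrow> enat" where
  "krull_dim R = Sup {enat (length Ps - 1) | Ps.
     Ps \<noteq> [] \<and> (\<forall>P \<in> set Ps. primeideal P R) \<and> sorted_wrt (\<subset>) Ps}"


subsection \<open>Depth\<close>

text \<open>The submodule \<open>x\<^sub>1 M + \<dots> + x\<^sub>r M\<close> of \<open>M\<close>.\<close>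

definition seq_smult :: "('a, 'm) ring_scheme \<Rightarrow> ('a, 'b, 'c) module_scheme \<Rightarrow> 'a list \<Rightarrow> 'b set" where
  "seq_smult R M xs =
     {(\<Oplus>\<^bsub>M\<^esub>i\<in>{..<length xs}. (xs ! i) \<odot>\<^bsub>M\<^esub> m i) | m. m \<in> {..<length xs} \<rightarrow> carrier M}"

text \<open>\<open>x\<^sub>i\<close> is a nonzerodivisor on \<open>M / (x\<^sub>1, \<dots>, x\<^sub>i\<^sub>-\<^sub>1) M\<close> for all \<open>i\<close>, and
  \<open>(x\<^sub>1, \<dots>, x\<^sub>r) M \<noteq> M\<close>.\<close>

definition regular_sequence ::
    "('a, 'm) ring_scheme \<Rightarrow> ('a, 'b, 'c) module_scheme \<Rightarrow> 'a list \<Rightarrow> bool" where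
  "regular_sequence R M xs \<longleftrightarrow>
     set xs \<subseteq> carrier R \<and>
     (\<forall>i < length xs. \<forall>m \<in> carrier M.
        (xs ! i) \<odot>\<^bsub>M\<^esub> m \<in> seq_smult R M (take i xs) \<longrightarrow> m \<in> seq_smult R M (take i xs)) \<and>
     seq_smult R M xs \<noteq> carrier M"

text \<open>The depth with respect to an ideal \<open>\<aa>\<close> with \<open>\<aa> M \<noteq> M\<close>; the convention
  \<open>depth M = \<infinity>\<close> in the case \<open>\<aa> M = M\<close> is not built in.\<close>

definition depth ::
    "('a, 'm) ring_scheme \<Rightarrow> 'a set \<Rightarrow> ('a, 'b, 'c) module_scheme \<Rightarrow> enat" where
  "depth R \<aa> M = Sup {enat (length xs) | xs. set xs \<subseteq> \<aa> \<and> regular_sequence R M xs}"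

text \<open>\<open>R / J\<close> as an \<open>R\<close>-module.\<close>

definition quot_module :: "('a, 'm) ring_scheme \<Rightarrow> 'a set \<Rightarrow> ('a, 'a set) module" where
  "quot_module R J = \<lparr>
     carrier = carrier (R Quot J), monoid.mult = monoid.mult (R Quot J), monoid.one = monoid.one (R Quot J),
     ring.zero = ring.zero (R Quot J), ring.add = ring.add (R Quot J),
     module.smult = (\<lambda>a C. (J +>\<^bsub>R\<^esub> a) \<otimes>\<^bsub>R Quot J\<^esub> C)\<rparr>"

lemma quot_module_is_module:
  assumes "cring R" "ideal J R"
  shows "module R (quot_module R J)"
proof -
  interpret R: cring R by fact
  interpret J: ideal J R by fact
  interpret Q: cring "R Quot J" using J.quotient_is_cring assms(1) .
  interpret h: ring_hom_ring R "R Quot J" "(+>\<^bsub>R\<^esub>) J" by (rule J.rcos_ring_hom_ring)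
  have "abelian_group (quot_module R J)"
    by (rule abelian_groupI)
       (auto simp: quot_module_def Q.a_ac intro!: Q.add.l_inv_ex)
  then show ?thesis
    by (intro moduleI assms)
       (use h.hom_closed h.hom_add h.hom_mult h.hom_one in
         \<open>auto simp: quot_module_def Q.l_distr Q.r_distr Q.m_assoc\<close>)
qed


subsection \<open>Powers of ideals and the stability index\<close>

text \<open>The library's monoid \<open>ideals_set R\<close> of ideals has unit \<open>carrier R\<close>, so \<open>I\<^sup>0 = R\<close>.\<close>

definition ideal_pow :: "('a, 'm) ring_scheme \<Rightarrow> 'a set \<Rightarrow> nat \<Rightarrow> 'a set" where
  "ideal_pow R I k = I [^]\<^bsub>ideals_set R\<^esub> k"

text \<open>The minimum is taken in \<^typ>\<open>enat\<close>: should the depth function fail to stabilise, the value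
  is \<open>\<infinity>\<close>.\<close>

definition dstab :: "('a, 'm) ring_scheme \<Rightarrow> 'a set \<Rightarrow> 'a set \<Rightarrow> enat" where
  "dstab R \<mm> I = Inf {enat k | k. k \<ge> 1 \<and>
     (\<forall>l \<ge> k. depth R \<mm> (quot_module R (ideal_pow R I k))
            = depth R \<mm> (quot_module R (ideal_pow R I l)))}"


subsection \<open>Rees ring and analytic spread\<close>

text \<open>The variable of \<^typ>\<open>'a poly\<close> plays the role of \<open>t\<close>.\<close>

definition rees_ring :: "'a :: comm_ring_1 set \<Rightarrow> 'a poly ring" where
  "rees_ring I = ring_of_type_algebra
     \<lparr>carrier := {p. \<forall>k. poly.coeff p k \<in> ideal_pow ring_of_type_algebra I k}\<rparr>"

lemma ideal_ideal_pow:
  assumes "cring R" "ideal I R"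
  shows "ideal (ideal_pow R I k) R"
proof -
  interpret cring R by fact
  interpret P: comm_monoid "ideals_set R" by (rule ideals_set_is_comm_monoid)
  show ?thesis
    using P.nat_pow_closed[of I k] assms(2) by (simp add: ideal_pow_def ideals_set_def)
qed

lemma ideal_pow_add:
  assumes "cring R" "ideal I R"
  shows "ideal_pow R I (j + k) = ideal_prod R (ideal_pow R I j) (ideal_pow R I k)"
proof -
  interpret cring R by fact
  interpret P: comm_monoid "ideals_set R" by (rule ideals_set_is_comm_monoid)
  show ?thesis
    using P.nat_pow_mult[of I j k] assms(2) by (simp add: ideal_pow_def ideals_set_def)
qed

lemma rees_ring_is_cring:
  fixes I :: "'a :: comm_ring_1 set"
  assumes "ideal I ring_of_type_algebra"
  shows "cring (rees_ring I)"
proof -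
  define S where "S = (ring_of_type_algebra :: 'a ring)"
  define P where "P = (ring_of_type_algebra :: 'a poly ring)"
  interpret S: cring S unfolding S_def by rule
  interpret P: cring P unfolding P_def by rule
  have id: "ideal (ideal_pow S I k) S" for k
    by (rule ideal_ideal_pow) (use assms S.is_cring in \<open>auto simp: S_def\<close>)
  have zero: "0 \<in> ideal_pow S I k" for k
    using additive_subgroup.zero_closed[OF ideal.axioms(1)[OF id]]
    by (simp add: S_def ring_of_type_algebra_def)
  have add: "a + b \<in> ideal_pow S I k" if "a \<in> ideal_pow S I k" "b \<in> ideal_pow S I k" for a b k
    using additive_subgroup.a_closed[OF ideal.axioms(1)[OF id] that]
    by (simp add: S_def ring_of_type_algebra_def)
  have mult: "a * b \<in> ideal_pow S I k" if "b \<in> ideal_pow S I k" for a b k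
    using ideal.I_l_closed[OF id that, of a]
    by (simp add: S_def ring_of_type_algebra_def)
  have prod: "a * b \<in> ideal_pow S I (j + k)"
    if "a \<in> ideal_pow S I j" "b \<in> ideal_pow S I k" for a b j k
    using ideal_prod.prod[OF that, of S] assms S.is_cring
    by (simp add: ideal_pow_add S_def ring_of_type_algebra_def)
  have sum: "sum f A \<in> ideal_pow S I k"
    if "finite A" "\<And>x. x \<in> A \<Longrightarrow> f x \<in> ideal_pow S I k" for f :: "nat \<Rightarrow> 'a" and A k
    using that by (induction A rule: finite_induct) (auto intro: zero add)
  have one: "1 \<in> ideal_pow S I 0"
    by (simp add: ideal_pow_def ideals_set_def S_def ring_of_type_algebra_def)
  define C where "C = {p. \<forall>k. poly.coeff p k \<in> ideal_pow S I k}"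
  have "subcring C P"
  proof (intro P.subcringI' P.subringI)
    fix p q assume pq: "p \<in> C" "q \<in> C"
    show "p \<otimes>\<^bsub>P\<^esub> q \<in> C"
      using pq prod
      by (auto simp: C_def P_def ring_of_type_algebra_def coeff_mult intro!: sum)
         (metis le_add_diff_inverse)
    show "p \<oplus>\<^bsub>P\<^esub> q \<in> C"
      using pq by (auto simp: C_def P_def ring_of_type_algebra_def intro: add)
    have "\<ominus>\<^bsub>P\<^esub> p = - p"
      by (rule P.minus_equality) (auto simp: P_def ring_of_type_algebra_def)
    moreover have "- p \<in> C"
      using pq mult[of _ _ "-1"] by (auto simp: C_def)
    ultimately show "\<ominus>\<^bsub>P\<^esub> p \<in> C" by simp
  qed (use zero one in \<open>auto simp: C_def P_def ring_of_type_algebra_def coeff_1\<close>)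
  then show ?thesis
    using P.subcring_iff[of C] by (simp add: rees_ring_def C_def P_def S_def ring_of_type_algebra_def)
qed

definition analytic_spread :: "'a :: comm_ring_1 set \<Rightarrow> 'a set \<Rightarrow> enat" where
  "analytic_spread \<mm> I =
     krull_dim (rees_ring I Quot (Idl\<^bsub>rees_ring I\<^esub> ((\<lambda>a. [:a:]) ` \<mm>)))"


section \<open>Polynomial rings and edge ideals\<close>

text \<open>The polynomials over \<open>'k\<close> in variables indexed by \<open>'n\<close>.\<close>

type_synonym ('n, 'k) mpoly = "('n \<Rightarrow>\<^sub>0 nat) \<Rightarrow>\<^sub>0 'k"

abbreviation mpoly_ring :: "('n, 'k :: field) mpoly ring" where
  "mpoly_ring \<equiv> ring_of_type_algebra"

definition mvar :: "'n \<Rightarrow> ('n, 'k :: field) mpoly" where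
  "mvar i = Poly_Mapping.single (Poly_Mapping.single i 1) 1"

definition graded_max_ideal :: "('n, 'k :: field) mpoly set" where
  "graded_max_ideal = Idl\<^bsub>mpoly_ring\<^esub> (range mvar)"

text \<open>A graph on the vertex set \<^term>\<open>UNIV :: 'n set\<close> is given by its set of edges.\<close>

definition simple_graph :: "'n set set \<Rightarrow> bool" where
  "simple_graph E \<longleftrightarrow> (\<forall>e \<in> E. card e = 2)"

definition connected_graph :: "'n set set \<Rightarrow> bool" where
  "connected_graph E \<longleftrightarrow> (\<forall>u v. (u, v) \<in> {(i, j). {i, j} \<in> E}\<^sup>*)"

definition edge_ideal :: "'n set set \<Rightarrow> ('n, 'k :: field) mpoly set" where
  "edge_ideal E = Idl\<^bsub>mpoly_ring\<^esub> {mvar i * mvar j | i j. {i, j} \<in> E}"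

end

theory Submission
  imports Defs
begin

text \<open>Write \<open>n\<close> for the number of vertices and \<open>e\<^sub>v\<close> for the exponent of the variable \<open>x\<^sub>v\<close>.
  The power \<open>I\<^sup>k\<close> is spanned by the monomials whose exponent dominates a sum of \<open>k\<close> edges, so
  everything reduces to such sums. The proof bounds \<open>dstab I\<close> from above and the analytic spread from
  below, by \<open>n - 2\<close> and \<open>n - 1\<close> if the graph is bipartite and by \<open>n - 1\<close> and \<open>n\<close> otherwise.

  All of these bounds come from one object. Growing a spanning tree one vertex at a time produces a
  two-colouring \<open>A\<close> of the vertices and a sum \<open>c\<close> of \<open>n - 3\<close> edges such that
  \<open>c + e\<^sub>a + e\<^sub>b\<close> is a sum of \<open>n - 2\<close> edges whenever \<open>a\<close> and \<open>b\<close> have different colours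
  (\<open>bicoloured_exchange_spanning\<close>). The exponent \<open>c\<close> plays the role of the product of the
  inner edges of the tree: on the tree path from \<open>a\<close> to \<open>b\<close> every other edge can be traded
  against its neighbours. Either every edge of the graph joins different colours, or some edge is
  monochromatic.

  In the monochromatic case that edge turns \<open>c\<close> into an exponent \<open>f\<close> of degree \<open>2 (n - 1) - 1\<close>
  such that \<open>f + e\<^sub>v\<close> is a sum of \<open>n - 1\<close> edges for every vertex \<open>v\<close>. Degrees show that
  \<open>x\<^sup>f\<close> is not in \<open>I\<^sup>n\<^sup>-\<^sup>1\<close>, hence it is a socle element of \<open>S / I\<^sup>n\<^sup>-\<^sup>1\<close>, and multiplying it by
  edges gives a socle element for all higher powers: their depth is \<open>0\<close>.

  In the bipartite case the depth of \<open>S / I\<^sup>l\<close> is \<open>1\<close> for all \<open>l \<ge> n - 2\<close>. It is at least \<open>1\<close> because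
  a weighted form of Koenig's theorem (\<open>weighted_koenig\<close>) writes \<open>I\<^sup>l\<close> as an intersection of
  powers of the primes generated by proper vertex covers, and the sum of all variables lies in none
  of these primes. It is at most \<open>1\<close> because \<open>(I\<^sup>l : x\<^sup>c)\<close> (with \<open>c\<close> multiplied by further edges)
  contains all \<open>x\<^sub>a x\<^sub>b\<close> with \<open>a\<close> and \<open>b\<close> of different colours but no monomial in the variables of a
  single colour: its zero set consists of two linear spaces that meet only in the origin, so it becomes
  disconnected once the origin is removed. The lemma
  \<open>no_regular_pair_mono_ideal\<close> is the elementary version of this remark.

  For the analytic spread, substituting \<open>1\<close> for the variables outside a set \<open>U\<close> gives a prime
  of the fibre ring for every \<open>U\<close>. Removing a vertex \<open>v\<close> from \<open>U\<close> makes the prime strictly larger as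
  soon as two sums of edges differ on \<open>U\<close> exactly in the coordinate \<open>v\<close>, and such sums
  are supplied by \<open>c\<close> and \<open>f\<close>.\<close>

section \<open>Sums of edges\<close>

definition vtx :: "'n \<Rightarrow> 'n \<Rightarrow>\<^sub>0 nat" where
  "vtx v = Poly_Mapping.single v 1"

text \<open>The exponents of the products of \<open>k\<close> generators of the edge ideal.\<close>

fun edge_sums :: "'n set set \<Rightarrow> nat \<Rightarrow> ('n \<Rightarrow>\<^sub>0 nat) set" where
  "edge_sums E 0 = {0}"
| "edge_sums E (Suc k) = {vtx i + vtx j + s | i j s. {i, j} \<in> E \<and> s \<in> edge_sums E k}"

text \<open>For \<open>C = UNIV\<close> this is the degree of the monomial; for a vertex cover \<open>C\<close> it is its order of
  vanishing along the coordinate subspace where the variables of \<open>C\<close> vanish.\<close>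

definition weight :: "'n :: finite set \<Rightarrow> ('n \<Rightarrow>\<^sub>0 nat) \<Rightarrow> nat" where
  "weight C a = (\<Sum>v\<in>C. Poly_Mapping.lookup a v)"

lemma lookup_vtx: "Poly_Mapping.lookup (vtx v) w = (if v = w then 1 else 0)"
  by (simp add: vtx_def lookup_single when_def)

lemma weight_zero [simp]: "weight C 0 = 0"
  by (simp add: weight_def)

lemma weight_add: "weight C (a + b) = weight C a + weight C b"
  by (simp add: weight_def lookup_add sum.distrib)

lemma weight_vtx: "weight C (vtx v) = (if v \<in> C then 1 else 0)"
  by (simp add: weight_def lookup_vtx)

lemma weight_alt: "weight C a = (\<Sum>v\<in>UNIV. if v \<in> C then Poly_Mapping.lookup a v else 0)"
  by (simp add: weight_def sum.If_cases)

lemma edge_sums_edge: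
  assumes "{i, j} \<in> E" "s \<in> edge_sums E k"
  shows "s + (vtx i + vtx j) \<in> edge_sums E (Suc k)"
  using assms by (auto simp: add.commute)

lemma edge_sums_add:
  assumes "s \<in> edge_sums E j" "t \<in> edge_sums E k"
  shows "s + t \<in> edge_sums E (j + k)"
  using assms
proof (induction j arbitrary: s)
  case (Suc j)
  then obtain a b s' where "{a, b} \<in> E" "s = vtx a + vtx b + s'" "s' \<in> edge_sums E j"
    by auto
  then show ?case
    using Suc.IH[of s'] Suc.prems(2) by (auto simp: add.assoc)
qed simp

lemma edge_sums_nonempty:
  assumes "{i, j} \<in> E"
  shows "\<exists>s. s \<in> edge_sums E k"
proof (induction k)
  case (Suc k)
  then show ?case using assms by auto
qed simp

lemma degree_edge_sums: "s \<in> edge_sums E k \<Longrightarrow> weight UNIV s = 2 * k"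
  by (induction k arbitrary: s) (auto simp: weight_add weight_vtx)

definition vertex_cover :: "'n set set \<Rightarrow> 'n set \<Rightarrow> bool" where
  "vertex_cover E C \<longleftrightarrow> (\<forall>i j. {i, j} \<in> E \<longrightarrow> i \<in> C \<or> j \<in> C)"

text \<open>The set \<open>A\<close> and its complement are the two colour classes of a bipartite graph.\<close>

definition crosses :: "'n set set \<Rightarrow> 'n set \<Rightarrow> bool" where
  "crosses E A \<longleftrightarrow> (\<forall>i j. {i, j} \<in> E \<longrightarrow> (i \<in> A \<longleftrightarrow> j \<notin> A))"

lemma weight_cover_edge_sums:
  "vertex_cover E C \<Longrightarrow> s \<in> edge_sums E k \<Longrightarrow> k \<le> weight C s"
proof (induction k arbitrary: s)
  case (Suc k)
  then obtain a b s' where s: "{a, b} \<in> E" "s = vtx a + vtx b + s'" "s' \<in> edge_sums E k"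
    by auto
  have "a \<in> C \<or> b \<in> C" using Suc.prems(1) s(1) by (auto simp: vertex_cover_def)
  moreover have "k \<le> weight C s'" using Suc s by blast
  ultimately show ?case by (auto simp: s(2) weight_add weight_vtx)
qed simp

lemma weight_class_edge_sums:
  "crosses E A \<Longrightarrow> s \<in> edge_sums E k \<Longrightarrow> weight A s = k"
proof (induction k arbitrary: s)
  case (Suc k)
  then obtain a b s' where s: "{a, b} \<in> E" "s = vtx a + vtx b + s'" "s' \<in> edge_sums E k"
    by auto
  have "a \<in> A \<longleftrightarrow> b \<notin> A" using Suc.prems(1) s(1) by (auto simp: crosses_def)
  moreover have "weight A s' = k" using Suc s by blast
  ultimately show ?case by (auto simp: s(2) weight_add weight_vtx)
qed simp

section \<open>Weighted Koenig theorem\<close>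

text \<open>In a bipartite graph the vertex covers form a lattice: one intersects the parts in \<open>A\<close> and unites
  the parts outside \<open>A\<close>, or the other way round. The weight is modular on this lattice, so covers
  of minimum weight are closed under both operations.\<close>

lemma uncross_covers:
  assumes A: "crosses E A" and C: "vertex_cover E C" "weight C a = m"
    and D: "vertex_cover E D" "weight D a = m"
    and min: "\<And>C. vertex_cover E C \<Longrightarrow> m \<le> weight C a"
  shows "vertex_cover E ((C \<inter> D \<inter> A) \<union> ((C \<union> D) - A))"
    and "weight ((C \<inter> D \<inter> A) \<union> ((C \<union> D) - A)) a = m"
proof -
  let ?M = "(C \<inter> D \<inter> A) \<union> ((C \<union> D) - A)"
  let ?J = "((C \<union> D) \<inter> A) \<union> ((C \<inter> D) - A)"
  have cov: "vertex_cover E ?M" "vertex_cover E ?J"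
    using A C(1) D(1) unfolding vertex_cover_def crosses_def by blast+
  have "weight ?M a + weight ?J a = weight C a + weight D a"
    unfolding weight_alt sum.distrib[symmetric] by (intro sum.cong) auto
  with cov[THEN min] C(2) D(2) show "weight ?M a = m" by linarith
  show "vertex_cover E ?M" by fact
qed

text \<open>Call a cover tight if its weight is the minimum \<open>m\<close>. If every neighbour \<open>v\<close> of \<open>u\<close> with positive weight
  shared a tight cover with \<open>u\<close>, uncrossing would produce a single tight cover containing \<open>u\<close>
  and all these neighbours. Then \<open>u\<close> could be exchanged against neighbours of weight \<open>0\<close>, giving
  a cover of smaller weight.\<close>

lemma tight_cover_no_blocked_vertex:
  fixes A :: "'n :: finite set"
  assumes A: "crosses E A" and u: "u \<in> A" "Poly_Mapping.lookup a u > 0"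
    and T: "vertex_cover E T" "u \<in> T" "weight T a = m"
    and min: "\<And>C. vertex_cover E C \<Longrightarrow> m \<le> weight C a"
  shows "\<exists>v. {u, v} \<in> E \<and> Poly_Mapping.lookup a v > 0 \<and>
           (\<forall>C. vertex_cover E C \<longrightarrow> u \<in> C \<longrightarrow> v \<in> C \<longrightarrow> weight C a \<noteq> m)"
proof (rule ccontr)
  assume neg: "\<not> ?thesis"
  let ?P = "\<lambda>C. vertex_cover E C \<and> u \<in> C \<and> weight C a = m"
  obtain D where D: "?P D" and max: "\<And>C. ?P C \<Longrightarrow> card (C - A) \<le> card (D - A)"
    using ex_has_greatest_nat[of ?P T "\<lambda>C. card (C - A)" "Suc CARD('n)"] T
    by (auto simp: card_mono less_Suc_eq_le)
  have nb: "v \<in> D" if v: "{u, v} \<in> E" "Poly_Mapping.lookup a v > 0" for v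
  proof -
    obtain C where C: "vertex_cover E C" "u \<in> C" "v \<in> C" "weight C a = m"
      using neg v by blast
    let ?M = "(C \<inter> D \<inter> A) \<union> ((C \<union> D) - A)"
    have "?P ?M"
      using uncross_covers[OF A C(1,4) _ _ min, of D] D C u(1) by blast
    from max[OF this] have "card (?M - A) \<le> card (D - A)" .
    moreover have "D - A \<subseteq> ?M - A" by blast
    ultimately have "?M - A = D - A"
      by (metis card_seteq finite)
    moreover have "v \<notin> A" using A v(1) u(1) by (auto simp: crosses_def)
    ultimately show "v \<in> D" using C(3) by blast
  qed
  \<comment> \<open>exchanging \<open>u\<close> for vertices of weight \<open>0\<close> beats the minimum\<close>
  let ?F = "(D - {u}) \<union> {v. Poly_Mapping.lookup a v = 0}"
  have "vertex_cover E ?F"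
    unfolding vertex_cover_def
  proof (intro allI impI)
    fix i j assume ij: "{i, j} \<in> E"
    have "{j, i} \<in> E" using ij by (simp add: insert_commute)
    moreover have "i \<in> D \<or> j \<in> D" using D ij by (auto simp: vertex_cover_def)
    moreover have "i \<noteq> j" using A ij by (auto simp: crosses_def)
    ultimately show "i \<in> ?F \<or> j \<in> ?F" using nb[of i] nb[of j] ij by auto
  qed
  then have "m \<le> weight ?F a" by (rule min)
  moreover have "weight ?F a + Poly_Mapping.lookup a u = weight D a"
  proof -
    have "weight ?F a = weight (D - {u}) a"
      unfolding weight_alt using u(2) by (intro sum.cong) auto
    then show ?thesis
      using D sum.remove[of D u "Poly_Mapping.lookup a"] by (simp add: weight_def)
  qed
  ultimately show False using D u(2) by linarith
qed

text \<open>If no tight cover contains both ends of an edge, then subtracting the edge from \<open>a\<close> lowers the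
  minimum weight of a cover by at most one. Such an edge always exists: a blocked edge lies in a tight
  cover, to which the preceding lemma applies with either colour class.\<close>

lemma exists_removable_edge:
  fixes A :: "'n :: finite set"
  assumes A: "crosses E A" and m: "m > 0"
    and min: "\<And>C. vertex_cover E C \<Longrightarrow> m \<le> weight C a"
  shows "\<exists>i j. {i, j} \<in> E \<and> Poly_Mapping.lookup a i > 0 \<and> Poly_Mapping.lookup a j > 0 \<and>
           (\<forall>C. vertex_cover E C \<longrightarrow> i \<in> C \<longrightarrow> j \<in> C \<longrightarrow> weight C a \<noteq> m)"
proof (rule ccontr)
  assume neg: "\<not> ?thesis"
  have "\<exists>i j. {i, j} \<in> E \<and> Poly_Mapping.lookup a i > 0 \<and> Poly_Mapping.lookup a j > 0"
  proof (rule ccontr)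
    assume "\<not> ?thesis"
    then have "vertex_cover E {v. Poly_Mapping.lookup a v = 0}"
      by (auto simp: vertex_cover_def)
    from min[OF this] m show False by (simp add: weight_def)
  qed
  then obtain i j where ij: "{i, j} \<in> E" "Poly_Mapping.lookup a i > 0" "Poly_Mapping.lookup a j > 0"
    by blast
  then obtain T where T: "vertex_cover E T" "i \<in> T" "weight T a = m"
    using neg by blast
  have "crosses E (- A)" using A by (auto simp: crosses_def)
  then show False
    using tight_cover_no_blocked_vertex[OF A _ ij(2) T min]
      tight_cover_no_blocked_vertex[OF _ _ ij(2) T min, of "- A"] neg ij(2) by blast
qed

text \<open>The weighted theorem of Koenig and Egervary. In algebraic terms: for a bipartite graph the
  \<open>k\<close>-th ordinary and symbolic powers of the edge ideal agree.\<close>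

lemma weighted_koenig:
  fixes A :: "'n :: finite set"
  assumes A: "crosses E A" and min: "\<And>C. vertex_cover E C \<Longrightarrow> k \<le> weight C a"
  shows "\<exists>s\<in>edge_sums E k. \<exists>r. a = s + r"
  using min
proof (induction k arbitrary: a)
  case (Suc k)
  obtain i j where ij: "{i, j} \<in> E" "Poly_Mapping.lookup a i > 0" "Poly_Mapping.lookup a j > 0"
    and free: "\<And>C. vertex_cover E C \<Longrightarrow> i \<in> C \<Longrightarrow> j \<in> C \<Longrightarrow> weight C a \<noteq> Suc k"
    using exists_removable_edge[OF A _ Suc.prems] by blast
  have "i \<noteq> j" using A ij(1) by (auto simp: crosses_def)
  define b where "b = a - vtx i - vtx j"
  have a: "a = vtx i + vtx j + b"
    using ij \<open>i \<noteq> j\<close>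
    by (intro poly_mapping_eqI) (auto simp: b_def lookup_add lookup_minus lookup_vtx)
  have "k \<le> weight C b" if "vertex_cover E C" for C
    using Suc.prems[OF that] free[OF that] by (auto simp: a weight_add weight_vtx split: if_splits)
  from Suc.IH[OF this] obtain s r where "s \<in> edge_sums E k" "b = s + r" by blast
  then have "vtx i + vtx j + s \<in> edge_sums E (Suc k)" "a = vtx i + vtx j + s + r"
    using ij(1) by (auto simp: a add.assoc)
  then show ?case by blast
qed simp

section \<open>Growing a spanning tree\<close>

lemma connected_graph_exit:
  assumes "connected_graph E" "w \<in> W" "W \<noteq> UNIV"
  shows "\<exists>p v. p \<in> W \<and> v \<notin> W \<and> {p, v} \<in> E"
proof (rule ccontr)
  assume neg: "\<not> ?thesis"
  obtain z where z: "z \<notin> W" using assms(3) by blast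
  have "(w, z) \<in> {(i, j). {i, j} \<in> E}\<^sup>*"
    using assms(1) by (auto simp: connected_graph_def)
  then have "z \<in> W"
    by (induction rule: rtrancl_induct) (use assms(2) neg in auto)
  with z show False by simp
qed

text \<open>Here \<open>W\<close> is the vertex set of the tree grown so far, coloured by membership in \<open>A\<close>, and \<open>c\<close> is a
  sum of edges that absorbs any differently coloured pair of vertices of \<open>W\<close> at the price of one
  more edge. The last conjunct keeps the growth going: it provides the partner with which a new
  vertex is traded.\<close>

definition bicoloured_exchange ::
    "'n set set \<Rightarrow> 'n set \<Rightarrow> 'n set \<Rightarrow> ('n \<Rightarrow>\<^sub>0 nat) \<Rightarrow> nat \<Rightarrow> bool" where
  "bicoloured_exchange E W A c k \<longleftrightarrow> c \<in> edge_sums E k \<and>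
     (\<forall>a\<in>W \<inter> A. \<forall>b\<in>W - A. c + vtx a + vtx b \<in> edge_sums E (Suc k)) \<and>
     (\<forall>w\<in>W. \<exists>w'\<in>W. {w, w'} \<in> E \<and> (w \<in> A \<longleftrightarrow> w' \<notin> A))"

lemma bicoloured_exchange_pair:
  assumes bal: "bicoloured_exchange E W A c k"
    and ab: "a \<in> W" "b \<in> W" "a \<in> A \<longleftrightarrow> b \<notin> A"
  shows "c + vtx a + vtx b \<in> edge_sums E (Suc k)"
proof (cases "a \<in> A")
  case True
  then show ?thesis using bal ab unfolding bicoloured_exchange_def by blast
next
  case False
  then have "c + vtx b + vtx a \<in> edge_sums E (Suc k)"
    using bal ab unfolding bicoloured_exchange_def by blast
  then show ?thesis by (simp only: add.assoc add.commute[of "vtx a"])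
qed

lemma bicoloured_exchange_neighbour:
  assumes "bicoloured_exchange E W A c k" "w \<in> W"
  shows "\<exists>w'\<in>W. {w, w'} \<in> E \<and> (w \<in> A \<longleftrightarrow> w' \<notin> A)"
  using assms unfolding bicoloured_exchange_def by blast

text \<open>The new vertex \<open>v\<close> is attached to \<open>p\<close>, whose partner is \<open>q\<close>; the edge from \<open>p\<close> to \<open>q\<close> is added to
  \<open>c\<close>. It gets the colour of \<open>q\<close>, so that \<open>q\<close> can take over the role of \<open>v\<close> in any pair.\<close>

lemma bicoloured_exchange_extend:
  assumes bal: "bicoloured_exchange E W A c k" and p: "p \<in> W" and v: "v \<notin> W" and pv: "{p, v} \<in> E"
  shows "\<exists>A' c'. bicoloured_exchange E (insert v W) A' c' (Suc k)"
proof -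
  obtain q where q: "q \<in> W" "{p, q} \<in> E" "p \<in> A \<longleftrightarrow> q \<notin> A"
    using bicoloured_exchange_neighbour[OF bal p] by blast
  define A' where "A' = (if p \<in> A then A - {v} else insert v A)"
  define c' where "c' = c + (vtx p + vtx q)"
  have A'W: "w \<in> A' \<longleftrightarrow> w \<in> A" if "w \<in> W" for w
    using that v by (auto simp: A'_def)
  have vA': "v \<in> A' \<longleftrightarrow> p \<notin> A" by (auto simp: A'_def)
  note old = bicoloured_exchange_pair[OF bal]
  \<comment> \<open>the new edge uses up \<open>v\<close> together with the \<open>p\<close> in \<open>c'\<close>; what remains is \<open>c\<close> with \<open>q\<close> and \<open>b\<close>\<close>
  have new: "c' + vtx v + vtx b \<in> edge_sums E (Suc (Suc k))"
    if "b \<in> W" "b \<in> A \<longleftrightarrow> p \<in> A" for b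
  proof -
    have "c + vtx q + vtx b + (vtx p + vtx v) \<in> edge_sums E (Suc (Suc k))"
      using edge_sums_edge[OF pv old[of q b]] q that by blast
    then show ?thesis by (simp add: c'_def add_ac)
  qed
  have "c' + vtx a + vtx b \<in> edge_sums E (Suc (Suc k))"
    if ab: "a \<in> insert v W" "b \<in> insert v W" "a \<in> A'" "b \<notin> A'" for a b
  proof -
    consider "a \<in> W" "b \<in> W" | "a = v" "b \<in> W" | "b = v" "a \<in> W"
      using ab by auto
    then show ?thesis
    proof cases
      case 1
      then have "c + vtx a + vtx b + (vtx p + vtx q) \<in> edge_sums E (Suc (Suc k))"
        using edge_sums_edge[OF q(2) old[of a b]] ab A'W by blast
      then show ?thesis by (simp add: c'_def add_ac)
    next
      case 2
      then show ?thesis using new[of b] ab A'W vA' by auto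
    next
      case 3
      then have "c' + vtx v + vtx a \<in> edge_sums E (Suc (Suc k))"
        using new[of a] ab A'W vA' by auto
      then show ?thesis using 3 by (simp only: add.assoc add.commute[of "vtx a"])
    qed
  qed
  moreover have "c' \<in> edge_sums E (Suc k)"
    using bal edge_sums_edge[OF q(2)] by (auto simp: bicoloured_exchange_def c'_def)
  moreover have "\<exists>w'\<in>insert v W. {w, w'} \<in> E \<and> (w \<in> A' \<longleftrightarrow> w' \<notin> A')" if "w \<in> insert v W" for w
  proof (cases "w = v")
    case True
    then show ?thesis using p pv A'W vA' by (auto simp: insert_commute intro!: bexI[of _ p])
  next
    case False
    then have "w \<in> W" using that by simp
    then obtain w' where "w' \<in> W" "{w, w'} \<in> E" "w \<in> A \<longleftrightarrow> w' \<notin> A"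
      using bicoloured_exchange_neighbour[OF bal] by blast
    then show ?thesis using A'W \<open>w \<in> W\<close> by blast
  qed
  ultimately have "bicoloured_exchange E (insert v W) A' c' (Suc k)"
    by (auto simp: bicoloured_exchange_def)
  then show ?thesis by blast
qed

text \<open>Growth starts from a path with three vertices, where no edge is needed in \<open>c\<close>. Starting from a
  single edge would cost one more edge and lose the strict inequality of the theorem.\<close>

lemma bicoloured_exchange_start:
  fixes E :: "'n :: finite set set"
  assumes "connected_graph E" "CARD('n) \<ge> 3"
  shows "\<exists>W A. card W = 3 \<and> bicoloured_exchange E W A 0 0"
proof -
  obtain x :: 'n where True by blast
  have small: "Y \<noteq> UNIV" if "card Y \<le> 2" for Y :: "'n set"
    using assms(2) that by auto
  have "{x} \<noteq> UNIV" by (rule small) simp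
  then obtain y where y: "y \<noteq> x" "{x, y} \<in> E"
    using connected_graph_exit[OF assms(1), of x "{x}"] by auto
  have "{x, y} \<noteq> UNIV" by (rule small) (simp add: card_insert_if)
  then obtain p z where z: "p \<in> {x, y}" "z \<notin> {x, y}" "{p, z} \<in> E"
    using connected_graph_exit[OF assms(1), of x "{x, y}"] by auto
  define z' where "z' = (if p = x then y else x)"
  have z': "z' \<noteq> p" "z' \<noteq> z" "{p, z'} \<in> E" "z \<noteq> p"
    using y z by (auto simp: z'_def insert_commute)
  have e: "{z', p} \<in> E" "{z, p} \<in> E" using z' z by (auto simp: insert_commute)
  have "\<forall>b\<in>{p, z', z} - {p}. vtx p + vtx b \<in> edge_sums E (Suc 0)"
    using z' z by auto
  then have "bicoloured_exchange E {p, z', z} {p} 0 0"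
    using z' z e by (auto simp: bicoloured_exchange_def)
  moreover have "card {p, z', z} = 3" using z' by auto
  ultimately show ?thesis by blast
qed

lemma bicoloured_exchange_spanning:
  fixes E :: "'n :: finite set set"
  assumes "connected_graph E" "CARD('n) \<ge> 3"
  shows "\<exists>A c. bicoloured_exchange E UNIV A c (CARD('n) - 3)"
proof -
  have "\<exists>W A c. card W = j + 3 \<and> bicoloured_exchange E W A c j" if "j + 3 \<le> CARD('n)" for j
    using that
  proof (induction j)
    case 0
    then show ?case using bicoloured_exchange_start[OF assms] by auto
  next
    case (Suc j)
    then obtain W A c where W: "card W = j + 3" "bicoloured_exchange E W A c j" by auto
    then obtain w where "w \<in> W" by fastforce
    moreover have "W \<noteq> UNIV" using W Suc.prems by auto
    ultimately obtain p v where pv: "p \<in> W" "v \<notin> W" "{p, v} \<in> E"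
      using connected_graph_exit[OF assms(1)] by blast
    moreover have "card (insert v W) = Suc j + 3" using W pv by simp
    ultimately show ?case using bicoloured_exchange_extend[OF W(2)] by blast
  qed
  from this[of "CARD('n) - 3"] assms(2) obtain W A c where
    "card W = CARD('n)" "bicoloured_exchange E W A c (CARD('n) - 3)" by auto
  moreover from this have "W = UNIV" by (simp add: card_eq_UNIV_imp_eq_UNIV)
  ultimately show ?thesis by blast
qed

text \<open>For the monochromatic edge from \<open>u\<close> to \<open>w\<close> and a partner \<open>y\<close> of \<open>w\<close> take
  \<open>f = c + e\<^sub>u + e\<^sub>w + e\<^sub>y\<close>. A vertex with the colour of \<open>w\<close> pairs with \<open>y\<close>, leaving the edge from \<open>u\<close>
  to \<open>w\<close>; a vertex of the other colour pairs with \<open>u\<close>, leaving the edge from \<open>w\<close> to \<open>y\<close>.\<close>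

lemma nonbipartite_socle_exponent:
  assumes bal: "bicoloured_exchange E UNIV A c k" and odd: "\<not> crosses E A"
  shows "\<exists>f. weight UNIV f = 2 * k + 3 \<and> (\<forall>v. f + vtx v \<in> edge_sums E (k + 2))"
proof -
  note old = bicoloured_exchange_pair[OF bal UNIV_I UNIV_I]
  obtain u w where uw: "{u, w} \<in> E" "u \<in> A \<longleftrightarrow> w \<in> A"
    using odd by (auto simp: crosses_def)
  obtain y where y: "{w, y} \<in> E" "w \<in> A \<longleftrightarrow> y \<notin> A"
    using bicoloured_exchange_neighbour[OF bal UNIV_I] by blast
  define f where "f = c + vtx u + vtx w + vtx y"
  have "f + vtx v \<in> edge_sums E (Suc (Suc k))" for v
  proof (cases "v \<in> A \<longleftrightarrow> w \<in> A")
    case True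
    then have "c + vtx v + vtx y + (vtx u + vtx w) \<in> edge_sums E (Suc (Suc k))"
      using edge_sums_edge[OF uw(1) old[of v y]] y(2) by blast
    then show ?thesis by (simp add: f_def add_ac)
  next
    case False
    then have "c + vtx v + vtx u + (vtx w + vtx y) \<in> edge_sums E (Suc (Suc k))"
      using edge_sums_edge[OF y(1) old[of v u]] uw(2) by blast
    then show ?thesis by (simp add: f_def add_ac)
  qed
  moreover have "weight UNIV f = 2 * k + 3"
    using bal degree_edge_sums[of c E k] by (simp add: f_def weight_add weight_vtx bicoloured_exchange_def)
  ultimately show ?thesis by auto
qed

section \<open>Monomial ideals\<close>

lemma ring_of_type_algebra_sel [simp]:
  "carrier (ring_of_type_algebra :: 'a :: comm_ring_1 ring) = UNIV"
  "x \<otimes>\<^bsub>(ring_of_type_algebra :: 'a ring)\<^esub> y = x * y"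
  "x \<oplus>\<^bsub>(ring_of_type_algebra :: 'a ring)\<^esub> y = x + y"
  "\<zero>\<^bsub>(ring_of_type_algebra :: 'a ring)\<^esub> = 0"
  "\<one>\<^bsub>(ring_of_type_algebra :: 'a ring)\<^esub> = 1"
  by (simp_all add: ring_of_type_algebra_def)

lemma ring_of_type_algebra_minus [simp]:
  "\<ominus>\<^bsub>(ring_of_type_algebra :: 'a :: comm_ring_1 ring)\<^esub> x = - x"
proof -
  interpret cring "ring_of_type_algebra :: 'a ring" by rule
  show ?thesis by (rule minus_equality) simp_all
qed

lemma ideal_ring_of_type_algebraI:
  fixes J :: "'a :: comm_ring_1 set"
  assumes "0 \<in> J" "\<And>a b. a \<in> J \<Longrightarrow> b \<in> J \<Longrightarrow> a + b \<in> J" "\<And>a x. a \<in> J \<Longrightarrow> x * a \<in> J"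
  shows "ideal J ring_of_type_algebra"
proof -
  interpret cring "ring_of_type_algebra :: 'a ring" by rule
  have "- a \<in> J" if "a \<in> J" for a
    using assms(3)[OF that, of "- 1"] by simp
  then show ?thesis
    by (intro idealI ring_axioms add.subgroupI)
      (use assms in \<open>auto simp: a_inv_def[symmetric] mult.commute\<close>)
qed

lemma
  fixes J :: "'a :: comm_ring_1 set"
  assumes "ideal J ring_of_type_algebra"
  shows ideal_zero: "0 \<in> J"
    and ideal_add: "a \<in> J \<Longrightarrow> b \<in> J \<Longrightarrow> a + b \<in> J"
    and ideal_mult: "a \<in> J \<Longrightarrow> x * a \<in> J"
    and ideal_diff: "a \<in> J \<Longrightarrow> b \<in> J \<Longrightarrow> a - b \<in> J"
proof -
  interpret ideal J "ring_of_type_algebra :: 'a ring" by fact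
  show z: "0 \<in> J"
    using additive_subgroup.zero_closed[OF ideal.axioms(1)[OF assms]] by simp
  show add: "a \<in> J \<Longrightarrow> b \<in> J \<Longrightarrow> a + b \<in> J" for a b
    using additive_subgroup.a_closed[OF ideal.axioms(1)[OF assms], of a b] by simp
  show mult: "a \<in> J \<Longrightarrow> x * a \<in> J" for a x using I_l_closed[of a x] by simp
  have um: "a \<in> J \<Longrightarrow> - a \<in> J" for a using mult[of a "- 1"] by simp
  show "a \<in> J \<Longrightarrow> b \<in> J \<Longrightarrow> a - b \<in> J" using add[OF _ um] by fastforce
qed

lemma ideal_sum:
  fixes J :: "'a :: comm_ring_1 set"
  assumes "ideal J ring_of_type_algebra" "\<And>x. x \<in> A \<Longrightarrow> f x \<in> J"
  shows "sum f A \<in> J"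
  using assms(2)
  by (induction A rule: infinite_finite_induct) (auto intro: ideal_zero ideal_add assms(1))

lemma sum_single_keys:
  fixes f :: "'a \<Rightarrow>\<^sub>0 'b :: comm_monoid_add"
  assumes "finite S" "Poly_Mapping.keys f \<subseteq> S"
  shows "(\<Sum>a\<in>S. Poly_Mapping.single a (Poly_Mapping.lookup f a)) = f"
proof (rule poly_mapping_eqI)
  fix k
  have "(\<Sum>a\<in>S. Poly_Mapping.lookup (Poly_Mapping.single a (Poly_Mapping.lookup f a)) k)
      = (\<Sum>a\<in>S. if k = a then Poly_Mapping.lookup f a else 0)"
    by (intro sum.cong) (auto simp: lookup_single when_def)
  then show "Poly_Mapping.lookup (\<Sum>a\<in>S. Poly_Mapping.single a (Poly_Mapping.lookup f a)) k
      = Poly_Mapping.lookup f k"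
    using assms by (auto simp: lookup_sum in_keys_iff)
qed

definition mono_ideal :: "('n \<Rightarrow>\<^sub>0 nat) set \<Rightarrow> ('n, 'k :: field) mpoly set" where
  "mono_ideal G = {f. \<forall>a\<in>Poly_Mapping.keys f. \<exists>s\<in>G. \<exists>r. a = s + r}"

lemma mono_ideal_single: "s \<in> G \<Longrightarrow> Poly_Mapping.single (s + r) c \<in> mono_ideal G"
  by (auto simp: mono_ideal_def)

lemma mono_ideal_ideal: "ideal (mono_ideal G :: ('n, 'k :: field) mpoly set) mpoly_ring"
proof (rule ideal_ring_of_type_algebraI)
  fix a b :: "('n, 'k) mpoly"
  assume "a \<in> mono_ideal G" "b \<in> mono_ideal G"
  then show "a + b \<in> mono_ideal G"
    using keys_add[of a b] unfolding mono_ideal_def by blast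
next
  fix a x :: "('n, 'k) mpoly"
  assume a: "a \<in> mono_ideal G"
  have "\<exists>s\<in>G. \<exists>r. e = s + r" if "e \<in> Poly_Mapping.keys (x * a)" for e
  proof -
    obtain d b where d: "b \<in> Poly_Mapping.keys a" "e = d + b"
      using keys_mult[of x a] \<open>e \<in> _\<close> by blast
    moreover from this a obtain s r where "s \<in> G" "b = s + r"
      by (auto simp: mono_ideal_def)
    ultimately show ?thesis by (intro bexI[of _ s] exI[of _ "d + r"]) (auto simp: add_ac)
  qed
  then show "x * a \<in> mono_ideal G" by (auto simp: mono_ideal_def)
qed (simp add: mono_ideal_def)

text \<open>A polynomial in a monomial ideal is the sum of its terms, each a multiple of a generator.\<close>

lemma mono_ideal_least:
  fixes J :: "('n, 'k :: field) mpoly set"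
  assumes J: "ideal J mpoly_ring" and G: "\<And>s. s \<in> G \<Longrightarrow> Poly_Mapping.single s 1 \<in> J"
  shows "mono_ideal G \<subseteq> J"
proof
  fix f :: "('n, 'k) mpoly" assume f: "f \<in> mono_ideal G"
  have "Poly_Mapping.single a (Poly_Mapping.lookup f a) \<in> J" if a: "a \<in> Poly_Mapping.keys f" for a
  proof -
    obtain s r where s: "s \<in> G" "a = s + r"
      using f a by (auto simp: mono_ideal_def)
    have "Poly_Mapping.single r (Poly_Mapping.lookup f a) * Poly_Mapping.single s 1 \<in> J"
      by (rule ideal_mult[OF J G[OF s(1)]])
    then show ?thesis by (simp add: mult_single s(2) add.commute)
  qed
  then have "(\<Sum>a\<in>Poly_Mapping.keys f. Poly_Mapping.single a (Poly_Mapping.lookup f a)) \<in> J"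
    by (intro ideal_sum[OF J])
  then show "f \<in> J" by (simp add: sum_single_keys)
qed

lemma Idl_monomials:
  "Idl\<^bsub>mpoly_ring\<^esub> ((\<lambda>s. Poly_Mapping.single s (1 :: 'k :: field)) ` G) = mono_ideal G"
proof -
  interpret cring "mpoly_ring :: ('n, 'k) mpoly ring" by rule
  show ?thesis
  proof (rule equalityI)
    show "Idl\<^bsub>mpoly_ring\<^esub> ((\<lambda>s. Poly_Mapping.single s (1 :: 'k)) ` G) \<subseteq> mono_ideal G"
      using mono_ideal_single[of _ G 0 "1 :: 'k"] by (intro genideal_minimal mono_ideal_ideal) auto
    show "mono_ideal G \<subseteq> Idl\<^bsub>mpoly_ring\<^esub> ((\<lambda>s. Poly_Mapping.single s (1 :: 'k)) ` G)"
      by (intro mono_ideal_least genideal_ideal) (auto intro!: genideal_self[THEN subsetD])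
  qed
qed

lemma ideal_prod_mono_ideal:
  fixes G H :: "('n \<Rightarrow>\<^sub>0 nat) set"
  shows "ideal_prod (mpoly_ring :: ('n, 'k :: field) mpoly ring) (mono_ideal G) (mono_ideal H)
       = mono_ideal {s + t | s t. s \<in> G \<and> t \<in> H}" (is "?L = mono_ideal ?Z")
proof (rule equalityI)
  interpret cring "mpoly_ring :: ('n, 'k) mpoly ring" by rule
  show "?L \<subseteq> mono_ideal ?Z"
  proof
    fix f assume "f \<in> ?L"
    then show "f \<in> mono_ideal ?Z"
    proof induction
      case (prod f g)
      have "\<exists>s\<in>?Z. \<exists>r. e = s + r" if "e \<in> Poly_Mapping.keys (f * g)" for e
      proof -
        obtain a b where ab: "a \<in> Poly_Mapping.keys f" "b \<in> Poly_Mapping.keys g" "e = a + b"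
          using keys_mult[of f g] \<open>e \<in> _\<close> by blast
        then obtain s r t r' where "s \<in> G" "a = s + r" "t \<in> H" "b = t + r'"
          using prod by (fastforce simp: mono_ideal_def)
        then show ?thesis using ab(3)
          by (intro bexI[of _ "s + t"] exI[of _ "r + r'"]) (auto simp: add_ac)
      qed
      then show ?case by (simp add: mono_ideal_def)
    next
      case (sum f g)
      then show ?case by (simp add: ideal_add[OF mono_ideal_ideal])
    qed
  qed
  show "mono_ideal ?Z \<subseteq> ?L"
  proof (rule mono_ideal_least)
    show "ideal ?L mpoly_ring" by (intro ideal_prod_is_ideal mono_ideal_ideal)
    fix z assume "z \<in> ?Z"
    then obtain s t where st: "s \<in> G" "t \<in> H" "z = s + t" by blast
    have "Poly_Mapping.single s 1 \<otimes>\<^bsub>mpoly_ring\<^esub> Poly_Mapping.single t 1 \<in> ?L"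
      using mono_ideal_single[OF st(1), of 0] mono_ideal_single[OF st(2), of 0]
      by (intro ideal_prod.prod) simp_all
    then show "Poly_Mapping.single z 1 \<in> ?L" by (simp add: mult_single st(3))
  qed
qed

lemma edge_ideal_eq_mono_ideal:
  "(edge_ideal E :: ('n, 'k :: field) mpoly set) = mono_ideal (edge_sums E 1)"
proof -
  have "{mvar i * mvar j | i j. {i, j} \<in> E} = (\<lambda>s. Poly_Mapping.single s (1 :: 'k)) ` edge_sums E 1"
    by (auto simp: mvar_def vtx_def mult_single image_iff)
  then show ?thesis by (simp add: edge_ideal_def Idl_monomials)
qed

lemma edge_ideal_ideal: "ideal (edge_ideal E :: ('n, 'k :: field) mpoly set) mpoly_ring"
  by (simp only: edge_ideal_eq_mono_ideal mono_ideal_ideal)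

lemma edge_ideal_pow:
  "ideal_pow mpoly_ring (edge_ideal E :: ('n, 'k :: field) mpoly set) k = mono_ideal (edge_sums E k)"
proof (induction k)
  case 0
  have "ideal_pow mpoly_ring (edge_ideal E :: ('n, 'k) mpoly set) 0 = UNIV"
    by (simp add: ideal_pow_def ideals_set_def)
  then show ?case by (auto simp: mono_ideal_def)
next
  case (Suc k)
  have 1: "ideal_pow mpoly_ring (edge_ideal E :: ('n, 'k) mpoly set) 1 = edge_ideal E"
  proof -
    interpret cring "mpoly_ring :: ('n, 'k) mpoly ring" by rule
    interpret P: comm_monoid "ideals_set (mpoly_ring :: ('n, 'k) mpoly ring)"
      by (rule ideals_set_is_comm_monoid)
    show ?thesis
      using edge_ideal_ideal[of E] P.nat_pow_eone unfolding ideal_pow_def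
      by (simp add: ideals_set_def)
  qed
  have sums: "{s + t | s t. s \<in> edge_sums E k \<and> t \<in> edge_sums E 1} = edge_sums E (Suc k)"
    by (auto simp: add.commute)
  have "ideal_pow mpoly_ring (edge_ideal E :: ('n, 'k) mpoly set) (k + 1) =
      ideal_prod mpoly_ring (mono_ideal (edge_sums E k)) (mono_ideal (edge_sums E 1))"
    using ideal_pow_add[OF cring_from_type_algebra edge_ideal_ideal[where ?'k = 'k], of E k 1] Suc.IH 1
    by (simp only: edge_ideal_eq_mono_ideal)
  then show ?case
    by (simp only: ideal_prod_mono_ideal sums Suc_eq_plus1)
qed

lemma graded_max_ideal_iff:
  "(f :: ('n, 'k :: field) mpoly) \<in> graded_max_ideal \<longleftrightarrow> Poly_Mapping.lookup f 0 = 0"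
proof -
  have "range mvar = (\<lambda>s. Poly_Mapping.single s (1 :: 'k)) ` range (vtx :: 'n \<Rightarrow> _)"
    by (auto simp: mvar_def vtx_def)
  then have m: "graded_max_ideal = (mono_ideal (range vtx) :: ('n, 'k) mpoly set)"
    by (simp add: graded_max_ideal_def Idl_monomials)
  have "(\<exists>s\<in>range vtx. \<exists>r. a = s + r) \<longleftrightarrow> a \<noteq> 0" for a :: "'n \<Rightarrow>\<^sub>0 nat"
  proof
    assume "\<exists>s\<in>range vtx. \<exists>r. a = s + r"
    then obtain v r where a: "a = vtx v + r" by blast
    then have "Poly_Mapping.lookup a v > 0" by (simp add: lookup_add lookup_vtx)
    then show "a \<noteq> 0" by auto
  next
    assume "a \<noteq> 0"
    then obtain v where "Poly_Mapping.lookup a v > 0"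
      by (metis gr0I lookup_zero poly_mapping_eqI)
    then have "a = vtx v + (a - vtx v)"
      by (intro poly_mapping_eqI) (auto simp: lookup_add lookup_minus lookup_vtx)
    then show "\<exists>s\<in>range vtx. \<exists>r. a = s + r" by blast
  qed
  then show ?thesis by (auto simp: m mono_ideal_def in_keys_iff)
qed

section \<open>Initial forms\<close>

text \<open>The part of weight \<open>i\<close> with respect to \<open>\<omega>\<close>, with exponents transported along \<open>\<rho>\<close>. If \<open>\<rho>\<close> is not injective,
  terms may merge; this is how variables are set to \<open>1\<close>.\<close>

definition init_form ::
    "('a \<Rightarrow> 'b) \<Rightarrow> ('a \<Rightarrow> nat) \<Rightarrow> nat \<Rightarrow> ('a \<Rightarrow>\<^sub>0 'k :: comm_monoid_add) \<Rightarrow> ('b \<Rightarrow>\<^sub>0 'k)" where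
  "init_form \<rho> \<omega> i f =
     (\<Sum>a\<in>Poly_Mapping.keys f. if \<omega> a = i then Poly_Mapping.single (\<rho> a) (Poly_Mapping.lookup f a) else 0)"

lemma init_form_superset:
  assumes "finite S" "Poly_Mapping.keys f \<subseteq> S"
  shows "init_form \<rho> \<omega> i f =
     (\<Sum>a\<in>S. if \<omega> a = i then Poly_Mapping.single (\<rho> a) (Poly_Mapping.lookup f a) else 0)"
  unfolding init_form_def using assms
  by (intro sum.mono_neutral_left) (auto simp: in_keys_iff)

lemma init_form_zero [simp]: "init_form \<rho> \<omega> i 0 = 0"
  by (simp add: init_form_def)

lemma init_form_single:
  "init_form \<rho> \<omega> i (Poly_Mapping.single a c) = (if \<omega> a = i then Poly_Mapping.single (\<rho> a) c else 0)"
  by (simp add: init_form_superset[of "{a}"])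

lemma init_form_add: "init_form \<rho> \<omega> i (f + g) = init_form \<rho> \<omega> i f + init_form \<rho> \<omega> i g"
proof -
  let ?S = "Poly_Mapping.keys f \<union> Poly_Mapping.keys g"
  have S: "finite ?S" "Poly_Mapping.keys f \<subseteq> ?S" "Poly_Mapping.keys g \<subseteq> ?S"
    "Poly_Mapping.keys (f + g) \<subseteq> ?S"
    using keys_add[of f g] by auto
  show ?thesis
    unfolding S(2-4)[THEN init_form_superset[OF S(1)]] sum.distrib[symmetric]
    by (intro sum.cong) (auto simp: lookup_add single_add)
qed

lemma init_form_sum: "init_form \<rho> \<omega> i (sum f A) = (\<Sum>x\<in>A. init_form \<rho> \<omega> i (f x))"
  by (induction A rule: infinite_finite_induct) (auto simp: init_form_add)

text \<open>If \<open>f\<close> and \<open>g\<close> have orders at least \<open>i\<close> and \<open>j\<close>, terms of order \<open>i + j\<close> in the product arise only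
  from terms of orders exactly \<open>i\<close> and \<open>j\<close>.\<close>

lemma init_form_mult:
  fixes f g :: "'a :: comm_monoid_add \<Rightarrow>\<^sub>0 'k :: comm_ring_1"
    and \<rho> :: "'a \<Rightarrow> 'b :: comm_monoid_add"
  assumes \<rho>: "\<And>a b. \<rho> (a + b) = \<rho> a + \<rho> b" and \<omega>: "\<And>a b. \<omega> (a + b) = \<omega> a + \<omega> b"
    and f: "\<And>a. a \<in> Poly_Mapping.keys f \<Longrightarrow> i \<le> \<omega> a"
    and g: "\<And>b. b \<in> Poly_Mapping.keys g \<Longrightarrow> j \<le> \<omega> b"
  shows "init_form \<rho> \<omega> (i + j) (f * g) = init_form \<rho> \<omega> i f * init_form \<rho> \<omega> j g"
proof -
  let ?F = "Poly_Mapping.lookup f" and ?G = "Poly_Mapping.lookup g"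
  have "f * g = (\<Sum>a\<in>Poly_Mapping.keys f. Poly_Mapping.single a (?F a)) *
                (\<Sum>b\<in>Poly_Mapping.keys g. Poly_Mapping.single b (?G b))"
    by (simp add: sum_single_keys)
  also have "\<dots> = (\<Sum>a\<in>Poly_Mapping.keys f. \<Sum>b\<in>Poly_Mapping.keys g.
                    Poly_Mapping.single (a + b) (?F a * ?G b))"
    by (simp add: sum_product mult_single)
  finally have "init_form \<rho> \<omega> (i + j) (f * g) =
      (\<Sum>a\<in>Poly_Mapping.keys f. \<Sum>b\<in>Poly_Mapping.keys g.
        if \<omega> (a + b) = i + j then Poly_Mapping.single (\<rho> (a + b)) (?F a * ?G b) else 0)"
    by (simp add: init_form_sum init_form_single)
  also have "\<dots> = (\<Sum>a\<in>Poly_Mapping.keys f. \<Sum>b\<in>Poly_Mapping.keys g.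
        (if \<omega> a = i then Poly_Mapping.single (\<rho> a) (?F a) else 0) *
        (if \<omega> b = j then Poly_Mapping.single (\<rho> b) (?G b) else 0))"
  proof (intro sum.cong refl)
    fix a b assume "a \<in> Poly_Mapping.keys f" "b \<in> Poly_Mapping.keys g"
    from f[OF this(1)] g[OF this(2)]
    show "(if \<omega> (a + b) = i + j then Poly_Mapping.single (\<rho> (a + b)) (?F a * ?G b) else 0) =
       (if \<omega> a = i then Poly_Mapping.single (\<rho> a) (?F a) else 0) *
        (if \<omega> b = j then Poly_Mapping.single (\<rho> b) (?G b) else 0)"
      by (auto simp: \<rho> \<omega> mult_single)
  qed
  also have "\<dots> = init_form \<rho> \<omega> i f * init_form \<rho> \<omega> j g"
    by (simp add: init_form_def sum_product)
  finally show ?thesis .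
qed

lemma lookup_init_form_inj:
  assumes "inj \<rho>" "\<omega> a = i"
  shows "Poly_Mapping.lookup (init_form \<rho> \<omega> i f) (\<rho> a) = Poly_Mapping.lookup f a"
proof -
  have "Poly_Mapping.lookup (init_form \<rho> \<omega> i f) (\<rho> a) =
      (\<Sum>b\<in>Poly_Mapping.keys f. if a = b then Poly_Mapping.lookup f b else 0)"
    unfolding init_form_def lookup_sum
    by (intro sum.cong) (use assms in \<open>auto simp: lookup_single when_def inj_eq\<close>)
  then show ?thesis by (simp add: in_keys_iff)
qed

text \<open>Forgetting the coordinates outside \<open>U\<close>. The indices are moved into the natural numbers because
  polynomials over the linearly ordered exponents \<^typ>\<open>nat \<Rightarrow>\<^sub>0 nat\<close> form an integral domain
  by comparison of leading terms, whereas \<^typ>\<open>'n\<close> carries no order; any injection will do.\<close>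

definition restrict_exp :: "'n :: finite set \<Rightarrow> ('n \<Rightarrow>\<^sub>0 nat) \<Rightarrow> (nat \<Rightarrow>\<^sub>0 nat)" where
  "restrict_exp U a =
     (\<Sum>v\<in>U. Poly_Mapping.single ((SOME h :: 'n \<Rightarrow> nat. inj h) v) (Poly_Mapping.lookup a v))"

lemma restrict_exp_add: "restrict_exp U (a + b) = restrict_exp U a + restrict_exp U b"
  by (simp add: restrict_exp_def lookup_add single_add sum.distrib)

lemma restrict_exp_zero [simp]: "restrict_exp U 0 = 0"
  by (simp add: restrict_exp_def)

lemma restrict_exp_eq_iff:
  fixes a b :: "'n :: finite \<Rightarrow>\<^sub>0 nat"
  shows "restrict_exp U a = restrict_exp U b \<longleftrightarrow>
    (\<forall>v\<in>U. Poly_Mapping.lookup a v = Poly_Mapping.lookup b v)"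
proof
  define h where "h = (SOME h :: 'n \<Rightarrow> nat. inj h)"
  have "\<exists>h :: 'n \<Rightarrow> nat. inj h"
    using finite_imp_inj_to_nat_seg[of "UNIV :: 'n set"] by auto
  then have h: "inj h" unfolding h_def by (rule someI_ex)
  have *: "Poly_Mapping.lookup (restrict_exp U c) (h v) = Poly_Mapping.lookup c v"
    if "v \<in> U" for v and c :: "'n \<Rightarrow>\<^sub>0 nat"
  proof -
    have "Poly_Mapping.lookup (restrict_exp U c) (h v) =
        (\<Sum>w\<in>U. if v = w then Poly_Mapping.lookup c w else 0)"
      unfolding restrict_exp_def h_def[symmetric] lookup_sum
      by (intro sum.cong) (use h in \<open>auto simp: lookup_single when_def inj_eq\<close>)
    then show ?thesis using that by simp
  qed
  assume "restrict_exp U a = restrict_exp U b"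
  then show "\<forall>v\<in>U. Poly_Mapping.lookup a v = Poly_Mapping.lookup b v"
    using * by metis
qed (simp add: restrict_exp_def cong: sum.cong)

section \<open>Depth of a quotient ring\<close>

context
  fixes J :: "'a :: comm_ring_1 set"
  assumes J: "ideal J ring_of_type_algebra"
begin

abbreviation cls :: "'a \<Rightarrow> 'a set" where
  "cls x \<equiv> J +>\<^bsub>ring_of_type_algebra\<^esub> x"

lemma cls_eq_iff: "cls x = cls y \<longleftrightarrow> x - y \<in> J"
proof -
  interpret cring "ring_of_type_algebra :: 'a ring" by rule
  have mem: "z \<in> cls x \<longleftrightarrow> z - x \<in> J" for x z
    by (auto simp: a_r_coset_def' intro!: bexI[of _ "z - x"])
  show ?thesis
  proof
    assume "cls x = cls y"
    moreover have "x \<in> cls x" using ideal_zero[OF J] by (simp add: mem)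
    ultimately show "x - y \<in> J" by (simp add: mem)
  next
    assume xy: "x - y \<in> J"
    have "z - x \<in> J \<longleftrightarrow> z - y \<in> J" for z
      using ideal_add[OF J _ xy, of "z - x"] ideal_diff[OF J _ xy, of "z - y"] by auto
    then show "cls x = cls y" by (auto simp: mem)
  qed
qed

lemma quot_module_sel:
  "carrier (quot_module ring_of_type_algebra J) = range cls"
  "\<zero>\<^bsub>quot_module ring_of_type_algebra J\<^esub> = cls 0"
  "a \<odot>\<^bsub>quot_module ring_of_type_algebra J\<^esub> cls x = cls (a * x)"
proof -
  interpret ideal J "ring_of_type_algebra :: 'a ring" by (rule J)
  interpret h: ring_hom_ring "ring_of_type_algebra :: 'a ring" "ring_of_type_algebra Quot J" cls
    by (rule rcos_ring_hom_ring)
  show "carrier (quot_module ring_of_type_algebra J) = range cls"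
    by (auto simp: quot_module_def FactRing_def A_RCOSETS_def')
  show "\<zero>\<^bsub>quot_module ring_of_type_algebra J\<^esub> = cls 0"
    using h.hom_zero by (simp add: quot_module_def)
  show "a \<odot>\<^bsub>quot_module ring_of_type_algebra J\<^esub> cls x = cls (a * x)"
    using h.hom_mult[of a x] by (simp add: quot_module_def)
qed

lemma seq_smult_quot_Nil:
  "seq_smult ring_of_type_algebra (quot_module ring_of_type_algebra J) [] = {cls 0}"
  by (auto simp: seq_smult_def finsum_def finprod_def quot_module_sel)

lemma seq_smult_quot_singleton:
  "seq_smult ring_of_type_algebra (quot_module ring_of_type_algebra J) [p] = {cls (p * r) | r. True}"
    (is "?L = ?R")
proof -
  let ?M = "quot_module ring_of_type_algebra J"
  interpret module "ring_of_type_algebra :: 'a ring" ?M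
    by (intro quot_module_is_module J) rule
  have fs: "(\<Oplus>\<^bsub>?M\<^esub>i\<in>{..<length [p]}. ([p] ! i) \<odot>\<^bsub>?M\<^esub> m i) = p \<odot>\<^bsub>?M\<^esub> m 0"
    if "m 0 \<in> carrier ?M" for m
  proof -
    have "p \<odot>\<^bsub>?M\<^esub> m 0 \<in> carrier ?M" using that by (auto simp: quot_module_sel)
    then show ?thesis by (simp add: lessThan_Suc Pi_def)
  qed
  show ?thesis
  proof (intro equalityI subsetI)
    fix C assume "C \<in> ?L"
    then obtain m where m: "m \<in> {..<length [p]} \<rightarrow> carrier ?M"
      "C = (\<Oplus>\<^bsub>?M\<^esub>i\<in>{..<length [p]}. ([p] ! i) \<odot>\<^bsub>?M\<^esub> m i)"
      by (auto simp only: seq_smult_def)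
    from m(1) have "m 0 \<in> carrier ?M" by (auto simp: Pi_def)
    moreover from this obtain r where "m 0 = cls r" by (auto simp: quot_module_sel)
    ultimately have "C = cls (p * r)" using m(2) fs[of m] by (simp add: quot_module_sel)
    then show "C \<in> ?R" by blast
  next
    fix C assume "C \<in> ?R"
    then obtain r where C: "C = cls (p * r)" by blast
    let ?m = "\<lambda>_ :: nat. cls r"
    have m: "?m \<in> {..<length [p]} \<rightarrow> carrier ?M" by (auto simp: quot_module_sel)
    have eq: "(\<Oplus>\<^bsub>?M\<^esub>i\<in>{..<length [p]}. ([p] ! i) \<odot>\<^bsub>?M\<^esub> ?m i) = C"
      using fs[of ?m] by (simp add: C quot_module_sel)
    show "C \<in> ?L"
      unfolding seq_smult_def by (intro CollectI exI[of _ ?m] conjI) (rule eq[symmetric], rule m)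
  qed
qed

lemma regular_sequence_first:
  assumes "regular_sequence ring_of_type_algebra (quot_module ring_of_type_algebra J) (p # ps)"
    and "p * f \<in> J"
  shows "f \<in> J"
proof -
  let ?M = "quot_module ring_of_type_algebra J"
  from assms(1) have "\<forall>i<length (p # ps). \<forall>m\<in>carrier ?M.
      ((p # ps) ! i) \<odot>\<^bsub>?M\<^esub> m \<in> seq_smult ring_of_type_algebra ?M (take i (p # ps)) \<longrightarrow>
      m \<in> seq_smult ring_of_type_algebra ?M (take i (p # ps))"
    unfolding regular_sequence_def by blast
  from this[rule_format, of 0 "cls f"] show ?thesis
    using assms(2) by (simp add: quot_module_sel seq_smult_quot_Nil cls_eq_iff rangeI)
qed

lemma regular_sequence_second:
  assumes reg: "regular_sequence ring_of_type_algebra (quot_module ring_of_type_algebra J) (p # q # ps)"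
    and "q * f - p * r \<in> J"
  shows "\<exists>r'. f - p * r' \<in> J"
proof -
  let ?M = "quot_module ring_of_type_algebra J"
  from reg have "\<forall>i<length (p # q # ps). \<forall>m\<in>carrier ?M.
      ((p # q # ps) ! i) \<odot>\<^bsub>?M\<^esub> m \<in> seq_smult ring_of_type_algebra ?M (take i (p # q # ps)) \<longrightarrow>
      m \<in> seq_smult ring_of_type_algebra ?M (take i (p # q # ps))"
    unfolding regular_sequence_def by blast
  from this[rule_format, of 1 "cls f"]
  have "cls (q * f) \<in> {cls (p * r) | r. True} \<Longrightarrow> cls f \<in> {cls (p * r) | r. True}"
    by (simp add: quot_module_sel seq_smult_quot_singleton)
  then show ?thesis using assms(2) by (auto simp: cls_eq_iff)
qed

lemma regular_sequence_singleton:
  assumes "\<And>f. p * f \<in> J \<Longrightarrow> f \<in> J" "\<And>r. 1 - p * r \<notin> J"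
  shows "regular_sequence ring_of_type_algebra (quot_module ring_of_type_algebra J) [p]"
  unfolding regular_sequence_def
proof (intro conjI)
  have "cls 1 \<notin> seq_smult ring_of_type_algebra (quot_module ring_of_type_algebra J) [p]"
    using assms(2) by (auto simp: seq_smult_quot_singleton cls_eq_iff)
  then show "seq_smult ring_of_type_algebra (quot_module ring_of_type_algebra J) [p] \<noteq>
      carrier (quot_module ring_of_type_algebra J)"
    by (auto simp: quot_module_sel)
qed (use assms(1) in \<open>auto simp: quot_module_sel seq_smult_quot_Nil cls_eq_iff\<close>)

text \<open>A socle element \<open>f\<close> is annihilated by every candidate for the first term of a regular
  sequence.\<close>

lemma depth_eq_0:
  assumes "f \<notin> J" "\<And>x. x \<in> \<mm> \<Longrightarrow> x * f \<in> J"
  shows "depth ring_of_type_algebra \<mm> (quot_module ring_of_type_algebra J) = 0"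
proof -
  have "xs = []" if xs: "set xs \<subseteq> \<mm>"
    "regular_sequence ring_of_type_algebra (quot_module ring_of_type_algebra J) xs" for xs
  proof (cases xs)
    case (Cons p ps)
    then show ?thesis using regular_sequence_first[of p ps f] assms xs by auto
  qed
  then have "depth ring_of_type_algebra \<mm> (quot_module ring_of_type_algebra J) \<le> 0"
    unfolding depth_def by (intro Sup_least) (auto simp: zero_enat_def)
  then show ?thesis by simp
qed

lemma depth_eq_1:
  assumes p: "p \<in> \<mm>" "\<And>f. p * f \<in> J \<Longrightarrow> f \<in> J" "\<And>r. 1 - p * r \<notin> J"
    and short: "\<And>p q qs. p \<in> \<mm> \<Longrightarrow> q \<in> \<mm> \<Longrightarrow>
      \<not> regular_sequence ring_of_type_algebra (quot_module ring_of_type_algebra J) (p # q # qs)"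
  shows "depth ring_of_type_algebra \<mm> (quot_module ring_of_type_algebra J) = 1"
proof (rule antisym)
  have "length xs \<le> 1" if xs: "set xs \<subseteq> \<mm>"
    "regular_sequence ring_of_type_algebra (quot_module ring_of_type_algebra J) xs" for xs
  proof (rule ccontr)
    assume "\<not> length xs \<le> 1"
    then obtain p ys where p: "xs = p # ys" "ys \<noteq> []" by (cases xs) auto
    then obtain q qs where "ys = q # qs" by (cases ys) auto
    then show False using short[of p q qs] xs p by simp
  qed
  then show "depth ring_of_type_algebra \<mm> (quot_module ring_of_type_algebra J) \<le> 1"
    unfolding depth_def by (intro Sup_least) (auto simp: one_enat_def)
  show "1 \<le> depth ring_of_type_algebra \<mm> (quot_module ring_of_type_algebra J)"
    unfolding depth_def using regular_sequence_singleton[of p] p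
    by (intro Sup_upper) (auto simp: one_enat_def intro!: exI[of _ "[p]"])
qed

end

section \<open>Depth of powers of edge ideals\<close>

lemma lookup_single_mult:
  fixes f :: "('n \<Rightarrow>\<^sub>0 nat) \<Rightarrow>\<^sub>0 'k :: comm_ring_1"
  shows "Poly_Mapping.lookup (Poly_Mapping.single d 1 * f) (d + c) = Poly_Mapping.lookup f c"
proof -
  have "Poly_Mapping.single d 1 * f = (\<Sum>a\<in>Poly_Mapping.keys f. Poly_Mapping.single (d + a) (Poly_Mapping.lookup f a))"
    by (subst sum_single_keys[of "Poly_Mapping.keys f" f, symmetric])
      (simp_all add: sum_distrib_left mult_single)
  then have "Poly_Mapping.lookup (Poly_Mapping.single d 1 * f) (d + c) =
      (\<Sum>a\<in>Poly_Mapping.keys f. if c = a then Poly_Mapping.lookup f a else 0)"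
    by (simp only: lookup_sum) (intro sum.cong, auto simp: lookup_single when_def)
  then show ?thesis by (simp add: in_keys_iff)
qed

lemma lookup_init_form_id:
  "Poly_Mapping.lookup (init_form (\<lambda>a. a) \<omega> i f) a = (if \<omega> a = i then Poly_Mapping.lookup f a else 0)"
proof -
  have "Poly_Mapping.lookup (init_form (\<lambda>a. a) \<omega> i f) a =
      (\<Sum>b\<in>Poly_Mapping.keys f. if a = b then if \<omega> a = i then Poly_Mapping.lookup f b else 0 else 0)"
    unfolding init_form_def lookup_sum
    by (intro sum.cong) (auto simp: lookup_single when_def)
  then show ?thesis by (simp add: in_keys_iff)
qed

lemma weight_pos_iff: "weight C a \<noteq> 0 \<longleftrightarrow> (\<exists>v\<in>C. Poly_Mapping.lookup a v \<noteq> 0)"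
  by (simp add: weight_def)

text \<open>Let \<open>F = x\<^sup>c\<close>. The first hypothesis says that modulo \<open>J\<close> the monomial \<open>F\<close> kills every product of a
  variable in \<open>A\<close> with one outside. Split off the part \<open>p\<^sub>A\<close> of \<open>p\<close> in the variables of \<open>A\<close>, and \<open>q\<^sub>A\<close>
  likewise; then \<open>q F p\<^sub>A\<close> and \<open>p F q\<^sub>A\<close> both equal \<open>F p\<^sub>A q\<^sub>A\<close> modulo \<open>J\<close>. If \<open>p, q\<close> were regular,
  \<open>F p\<^sub>A\<close> would be \<open>p r\<close> modulo \<open>J\<close>. Cancelling \<open>p\<close> shows that \<open>x\<^sub>b r\<close> and \<open>x\<^sub>a (F - r)\<close> lie in \<open>J\<close>: \<open>r\<close> behaves
  like the function that is \<open>F\<close> on one component and \<open>0\<close> on the other. As \<open>J\<close> is monomial,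
  the coefficient of \<open>r\<close> at \<open>c\<close> would have to be both \<open>0\<close> and \<open>1\<close>.\<close>

lemma no_regular_pair_mono_ideal:
  fixes p q :: "('n :: finite, 'k :: field) mpoly"
  assumes mixed: "\<And>a b. a \<in> A \<Longrightarrow> b \<notin> A \<Longrightarrow> \<exists>s\<in>G. \<exists>r. c + vtx a + vtx b = s + r"
    and a: "a \<in> A" "\<not> (\<exists>s\<in>G. \<exists>r. c + vtx a = s + r)"
    and b: "b \<notin> A" "\<not> (\<exists>s\<in>G. \<exists>r. c + vtx b = s + r)"
    and p: "p \<in> graded_max_ideal" and q: "q \<in> graded_max_ideal"
  shows "\<not> regular_sequence mpoly_ring (quot_module mpoly_ring (mono_ideal G)) (p # q # qs)"
proof
  assume reg: "regular_sequence mpoly_ring (quot_module mpoly_ring (mono_ideal G)) (p # q # qs)"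
  define J where "J = (mono_ideal G :: ('n, 'k) mpoly set)"
  have J: "ideal J mpoly_ring" unfolding J_def by (rule mono_ideal_ideal)
  define F where "F = (Poly_Mapping.single c 1 :: ('n, 'k) mpoly)"
  define x where "x = (\<lambda>v. Poly_Mapping.single (vtx v) 1 :: ('n, 'k) mpoly)"
  define pure where "pure = (\<lambda>f :: ('n, 'k) mpoly. init_form (\<lambda>a. a) (weight (- A)) 0 f)"
  define inA where "inA = (\<lambda>f :: ('n, 'k) mpoly. \<forall>e\<in>Poly_Mapping.keys f. weight A e \<noteq> 0)"
  define inB where "inB = (\<lambda>f :: ('n, 'k) mpoly. \<forall>e\<in>Poly_Mapping.keys f. weight (- A) e \<noteq> 0)"
  \<comment> \<open>\<open>F\<close> kills products of a factor divisible by variables of \<open>A\<close> with one divisible by variables outside\<close>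
  have J_I: "F * (f * g) \<in> J" if f: "inA f" and g: "inB g" for f g
  proof -
    have "\<exists>s\<in>G. \<exists>r. e = s + r" if "e \<in> Poly_Mapping.keys (F * (f * g))" for e
    proof -
      obtain d where d: "d \<in> Poly_Mapping.keys (f * g)" "e = c + d"
        using keys_mult[of F "f * g"] \<open>e \<in> _\<close> by (auto simp: F_def)
      then obtain u v where uv: "u \<in> Poly_Mapping.keys f" "v \<in> Poly_Mapping.keys g" "d = u + v"
        using keys_mult[of f g] by blast
      obtain i j where ij: "i \<in> A" "Poly_Mapping.lookup u i \<noteq> 0" "j \<notin> A" "Poly_Mapping.lookup v j \<noteq> 0"
        using f g uv unfolding inA_def inB_def weight_pos_iff by blast
      have "u = vtx i + (u - vtx i)" "v = vtx j + (v - vtx j)"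
        using ij by (auto intro!: poly_mapping_eqI simp: lookup_add lookup_minus lookup_vtx)
      then have "e = (c + vtx i + vtx j) + ((u - vtx i) + (v - vtx j))"
        by (metis d(2) uv(3) add.assoc add.left_commute)
      moreover obtain s r where "s \<in> G" "c + vtx i + vtx j = s + r" using mixed ij by blast
      ultimately have "e = s + (r + ((u - vtx i) + (v - vtx j)))" by (metis add.assoc)
      then show ?thesis using \<open>s \<in> G\<close> by blast
    qed
    then show ?thesis by (simp add: J_def mono_ideal_def)
  qed
  have pureA: "inA (pure f)" if "f \<in> graded_max_ideal" for f
    unfolding inA_def
  proof (intro ballI notI)
    fix e assume e: "e \<in> Poly_Mapping.keys (pure f)" "weight A e = 0"
    then have e': "weight (- A) e = 0" "Poly_Mapping.lookup f e \<noteq> 0"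
      by (auto simp: pure_def in_keys_iff lookup_init_form_id split: if_splits)
    have "Poly_Mapping.lookup e v = 0" for v
      using e(2) e'(1) by (cases "v \<in> A") (auto simp: weight_def)
    then have "e = 0" by (intro poly_mapping_eqI) simp
    with e'(2) that show False by (simp add: graded_max_ideal_iff)
  qed
  have restB: "inB (f - pure f)" for f
    by (auto simp: inB_def pure_def in_keys_iff lookup_minus lookup_init_form_id split: if_splits)
  have xA: "inA (x v)" if "v \<in> A" for v using that by (simp add: inA_def x_def weight_vtx)
  have xB: "inB (x v)" if "v \<notin> A" for v using that by (simp add: inB_def x_def weight_vtx)
  have "q * (F * pure p) - p * (F * pure q) =
      F * (pure p * (q - pure q)) - F * (pure q * (p - pure p))"
    by (simp add: algebra_simps)
  also have "\<dots> \<in> J"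
    by (intro ideal_diff[OF J] J_I pureA restB p q)
  finally obtain r where r: "F * pure p - p * r \<in> J"
    using regular_sequence_second[OF J reg[folded J_def]] by blast
  have "F * (pure p * x b) - x b * (F * pure p - p * r) \<in> J"
    by (intro ideal_diff[OF J] J_I pureA xB p b ideal_mult[OF J] r)
  then have "p * (x b * r) \<in> J" by (simp add: algebra_simps)
  from regular_sequence_first[OF J reg[folded J_def] this] have 0: "x b * r \<in> J" .
  have "x a * (F * pure p - p * r) + F * (x a * (p - pure p)) \<in> J"
    by (intro ideal_add[OF J] J_I xA restB a ideal_mult[OF J] r)
  then have "p * (x a * (F - r)) \<in> J" by (simp add: algebra_simps)
  from regular_sequence_first[OF J reg[folded J_def] this] have 1: "x a * (F - r) \<in> J" .
  \<comment> \<open>as \<open>J\<close> is monomial, membership is tested term by term, here at the exponent \<open>c + e\<^sub>v\<close>\<close>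
  have coeff: "Poly_Mapping.lookup f c = 0"
    if "x v * f \<in> J" "\<not> (\<exists>s\<in>G. \<exists>r. c + vtx v = s + r)" for v f
  proof -
    have "vtx v + c \<notin> Poly_Mapping.keys (x v * f)"
      using that unfolding J_def mono_ideal_def by (auto simp: add.commute)
    then show ?thesis by (simp add: in_keys_iff x_def lookup_single_mult)
  qed
  show False
    using coeff[OF 0 b(2)] coeff[OF 1 a(2)] by (simp add: F_def lookup_minus)
qed

lemma edge_power_not_mem_degree:
  "2 * k > weight UNIV a \<Longrightarrow> \<not> (\<exists>s\<in>edge_sums E k. \<exists>r. a = s + r)"
  using degree_edge_sums[of _ E k] by (force simp: weight_add)

text \<open>The monomial \<open>x\<^sup>f\<close> is a socle element of the quotient: its degree is one too small for it to lie in
  the \<open>k\<close>-th power.\<close>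

lemma depth_nonbipartite_power:
  fixes E :: "'n :: finite set set"
  assumes f: "weight UNIV f + 1 = 2 * k" "\<And>v. f + vtx v \<in> edge_sums E k"
  shows "depth mpoly_ring graded_max_ideal
    (quot_module mpoly_ring (ideal_pow mpoly_ring (edge_ideal E :: ('n, 'k :: field) mpoly set) k)) = 0"
  unfolding edge_ideal_pow
proof (rule depth_eq_0[OF mono_ideal_ideal])
  show "Poly_Mapping.single f 1 \<notin> (mono_ideal (edge_sums E k) :: ('n, 'k) mpoly set)"
    using edge_power_not_mem_degree[of f k E] f(1) by (simp add: mono_ideal_def)
  fix x :: "('n, 'k) mpoly" assume x: "x \<in> graded_max_ideal"
  have "\<exists>s\<in>edge_sums E k. \<exists>r. e = s + r"
    if "e \<in> Poly_Mapping.keys (x * Poly_Mapping.single f 1)" for e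
  proof -
    obtain d where d: "d \<in> Poly_Mapping.keys x" "e = d + f"
      using keys_mult[of x "Poly_Mapping.single f 1"] \<open>e \<in> _\<close> by auto
    have "d \<noteq> 0" using d(1) x by (auto simp: graded_max_ideal_iff in_keys_iff)
    then obtain v where "Poly_Mapping.lookup d v \<noteq> 0"
      by (metis lookup_zero poly_mapping_eqI)
    then have "d = vtx v + (d - vtx v)"
      by (auto intro!: poly_mapping_eqI simp: lookup_add lookup_minus lookup_vtx)
    then have "e = (f + vtx v) + (d - vtx v)"
      by (metis d(2) add.commute add.left_commute)
    then show ?thesis using f(2) by blast
  qed
  then show "x * Poly_Mapping.single f 1 \<in> mono_ideal (edge_sums E k)"
    by (simp add: mono_ideal_def)
qed

text \<open>If \<open>f\<close> is not in \<open>I\<^sup>k\<close>, Koenig's theorem yields a vertex cover along which \<open>f\<close> has order \<open>d < k\<close>. It can be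
  chosen to omit some vertex, since a colour class is a cover. Along this cover the sum of all
  variables has order \<open>0\<close>, so its product with \<open>f\<close> still has order \<open>d\<close>: the initial forms multiply in
  an integral domain.\<close>

lemma bipartite_nonzerodivisor:
  fixes E :: "'n :: finite set set" and f :: "('n, 'k :: field) mpoly"
  assumes A: "crosses E A" "A \<noteq> UNIV"
    and pf: "(\<Sum>v\<in>UNIV. mvar v) * f \<in> mono_ideal (edge_sums E k)"
  shows "f \<in> mono_ideal (edge_sums E k)"
proof (rule ccontr)
  assume "f \<notin> mono_ideal (edge_sums E k)"
  then obtain e where e: "e \<in> Poly_Mapping.keys f" "\<not> (\<exists>s\<in>edge_sums E k. \<exists>r. e = s + r)"
    by (auto simp: mono_ideal_def)
  then obtain C' where C': "vertex_cover E C'" "weight C' e < k"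
    using weighted_koenig[OF A(1), of k e] by (meson not_le)
  obtain C where C: "vertex_cover E C" "weight C e < k" "C \<noteq> UNIV"
  proof (cases "C' = UNIV")
    case True
    have "weight A e \<le> weight C' e" unfolding True weight_def by (intro sum_mono2) auto
    moreover have "vertex_cover E A" using A(1) by (auto simp: crosses_def vertex_cover_def)
    ultimately show ?thesis using that[of A] C' A(2) by simp
  qed (use that C' in auto)
  obtain v where v: "v \<notin> C" using C(3) by blast
  let ?p = "\<Sum>v\<in>UNIV. mvar v :: ('n, 'k) mpoly"
  let ?in = "init_form (restrict_exp UNIV) (weight C) :: nat \<Rightarrow> ('n, 'k) mpoly \<Rightarrow> _"
  have inj: "inj (restrict_exp (UNIV :: 'n set))"
    by (auto simp: inj_def restrict_exp_eq_iff intro: poly_mapping_eqI)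
  obtain d e' where d: "e' \<in> Poly_Mapping.keys f" "weight C e' = d" "d < k"
    and min: "\<And>a. a \<in> Poly_Mapping.keys f \<Longrightarrow> d \<le> weight C a"
  proof -
    obtain e' where e': "e' \<in> Poly_Mapping.keys f"
      "\<And>a. a \<in> Poly_Mapping.keys f \<Longrightarrow> weight C e' \<le> weight C a"
      using ex_has_least_nat[of "\<lambda>a. a \<in> Poly_Mapping.keys f" e "weight C"] e(1) by blast
    then show ?thesis using that[of e' "weight C e'"] e'(2)[OF e(1)] C(2) by simp
  qed
  have "?in (0 + d) (?p * f) = ?in 0 ?p * ?in d f"
    by (rule init_form_mult) (use min in \<open>auto simp: restrict_exp_add weight_add\<close>)
  moreover have "?in (0 + d) (?p * f) = 0"
  proof -
    have "weight C a \<noteq> d" if a: "a \<in> Poly_Mapping.keys (?p * f)" for a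
    proof -
      obtain s r where "s \<in> edge_sums E k" "a = s + r"
        using pf a by (auto simp: mono_ideal_def)
      then show ?thesis
        using weight_cover_edge_sums[OF C(1), of s k] d(3) by (simp add: weight_add)
    qed
    then show ?thesis by (simp add: init_form_def)
  qed
  moreover have "?in d f \<noteq> 0"
    using lookup_init_form_inj[OF inj, of "weight C" e' d f] d by (auto simp: in_keys_iff)
  moreover have "?in 0 ?p \<noteq> 0"
  proof -
    have "Poly_Mapping.lookup ?p (vtx v) = (\<Sum>w\<in>UNIV. if v = w then 1 else 0)"
      unfolding lookup_sum
    proof (intro sum.cong refl)
      fix w :: 'n
      have "vtx w = vtx v \<longleftrightarrow> w = v"
        using lookup_vtx[of w w] lookup_vtx[of v w] by (metis zero_neq_one)
      then show "Poly_Mapping.lookup (mvar w :: ('n, 'k) mpoly) (vtx v) = (if v = w then 1 else 0)"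
        by (auto simp: mvar_def vtx_def lookup_single when_def)
    qed
    then have "Poly_Mapping.lookup ?p (vtx v) \<noteq> 0" by simp
    moreover have "weight C (vtx v) = 0" using v by (simp add: weight_vtx)
    ultimately show ?thesis
      using lookup_init_form_inj[OF inj, of "weight C" "vtx v" 0 ?p] by auto
  qed
  ultimately show False by simp
qed

text \<open>By bipartiteness \<open>c\<close> has weight \<open>k\<close> in each colour class, so \<open>c + e\<^sub>a\<close> has weight \<open>k\<close> in the class not containing
  \<open>a\<close>. A sum of \<open>k + 1\<close> edges has weight \<open>k + 1\<close> in both, so none divides \<open>c + e\<^sub>a\<close>.\<close>

lemma depth_bipartite_power:
  fixes E :: "'n :: finite set set"
  assumes A: "crosses E A" and a: "a \<in> A" and b: "b \<notin> A"
    and c: "c \<in> edge_sums E k"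
    and mixed: "\<And>a b. a \<in> A \<Longrightarrow> b \<notin> A \<Longrightarrow> c + vtx a + vtx b \<in> edge_sums E (Suc k)"
  shows "depth mpoly_ring graded_max_ideal
    (quot_module mpoly_ring (ideal_pow mpoly_ring (edge_ideal E :: ('n, 'k :: field) mpoly set) (Suc k))) = 1"
  unfolding edge_ideal_pow
proof (rule depth_eq_1[OF mono_ideal_ideal])
  let ?p = "\<Sum>v\<in>UNIV. mvar v :: ('n, 'k) mpoly"
  let ?J = "mono_ideal (edge_sums E (Suc k)) :: ('n, 'k) mpoly set"
  interpret cring "mpoly_ring :: ('n, 'k) mpoly ring" by rule
  have m: "ideal (graded_max_ideal :: ('n, 'k) mpoly set) mpoly_ring"
    unfolding graded_max_ideal_def by (rule genideal_ideal) simp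
  have "mvar v \<in> (graded_max_ideal :: ('n, 'k) mpoly set)" for v
    unfolding graded_max_ideal_def by (intro genideal_self[THEN subsetD]) auto
  then show p: "?p \<in> graded_max_ideal"
    by (intro ideal_sum[OF m])
  show "f \<in> ?J" if "?p * f \<in> ?J" for f
    using bipartite_nonzerodivisor[OF A _ that] b by blast
  show "1 - ?p * r \<notin> ?J" for r
  proof
    assume "1 - ?p * r \<in> ?J"
    moreover have "Poly_Mapping.lookup (1 - ?p * r) 0 = 1"
      using ideal_mult[OF m p, of r] by (simp add: graded_max_ideal_iff lookup_minus mult.commute)
    then have "0 \<in> Poly_Mapping.keys (1 - ?p * r)" by (simp add: in_keys_iff)
    ultimately have "\<exists>s\<in>edge_sums E (Suc k). \<exists>r. 0 = s + r"
      unfolding mono_ideal_def by blast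
    then show False using edge_power_not_mem_degree[of 0 "Suc k" E] by simp
  qed
  have weight: "weight A c = k" "weight (- A) c = k"
    using weight_class_edge_sums[OF _ c, of A] weight_class_edge_sums[OF _ c, of "- A"] A
    by (auto simp: crosses_def)
  have "\<not> (\<exists>s\<in>edge_sums E (Suc k). \<exists>r. c + vtx a = s + r)"
  proof
    assume "\<exists>s\<in>edge_sums E (Suc k). \<exists>r. c + vtx a = s + r"
    then obtain s r where s: "s \<in> edge_sums E (Suc k)" "c + vtx a = s + r" by blast
    have "weight (- A) s = Suc k" using weight_class_edge_sums[OF _ s(1), of "- A"] A by (auto simp: crosses_def)
    then show False using arg_cong[OF s(2), of "weight (- A)"] weight a by (simp add: weight_add weight_vtx)
  qed
  moreover have "\<not> (\<exists>s\<in>edge_sums E (Suc k). \<exists>r. c + vtx b = s + r)"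
  proof
    assume "\<exists>s\<in>edge_sums E (Suc k). \<exists>r. c + vtx b = s + r"
    then obtain s r where s: "s \<in> edge_sums E (Suc k)" "c + vtx b = s + r" by blast
    have "weight A s = Suc k" using weight_class_edge_sums[OF A s(1)] .
    then show False using arg_cong[OF s(2), of "weight A"] weight b by (simp add: weight_add weight_vtx)
  qed
  ultimately show "\<not> regular_sequence mpoly_ring (quot_module mpoly_ring ?J) (p # q # qs)"
    if "p \<in> graded_max_ideal" "q \<in> graded_max_ideal" for p q qs
    using mixed a b that
    by (intro no_regular_pair_mono_ideal[where A = A and c = c and a = a and b = b])
      (auto simp del: edge_sums.simps intro!: bexI exI[of _ 0])
qed

section \<open>Chains of primes in the fibre ring\<close>

lemma domain_ring_of_type_algebra: "domain (ring_of_type_algebra :: 'a :: idom ring)"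
proof -
  interpret cring "ring_of_type_algebra :: 'a ring" by rule
  show ?thesis by unfold_locales auto
qed

text \<open>Primes above \<open>J\<close> descend to the quotient, strict inclusions included.\<close>

lemma krull_dim_quotient_ge:
  fixes R (structure)
  assumes "cring R" and J: "ideal J R" and ne: "Ps \<noteq> []"
    and Ps: "\<And>P. P \<in> set Ps \<Longrightarrow> primeideal P R \<and> J \<subseteq> P" and chain: "sorted_wrt (\<subset>) Ps"
  shows "enat (length Ps - 1) \<le> krull_dim (R Quot J)"
proof -
  interpret cring R by fact
  interpret J: ideal J R by fact
  interpret h: ring_hom_ring R "R Quot J" "(+>) J" by (rule J.rcos_ring_hom_ring)
  let ?Q = "(\<lambda>P. (+>) J ` P)"
  have carr: "?Q P \<subseteq> carrier (R Quot J)" if "P \<in> set Ps" for P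
    using ideal.Icarr[OF primeideal.axioms(1), of P R] Ps[OF that] h.hom_closed by blast
  have union: "\<Union> (?Q P) = P" if "P \<in> set Ps" for P
    using ideal_incl_iff[OF J, of P] Ps[OF that] primeideal.axioms(1) by blast
  have mem: "J +> x \<in> ?Q P \<longleftrightarrow> x \<in> P" if "P \<in> set Ps" "x \<in> carrier R" for P x
    using canonical_proj_vimage_mem_iff[OF J carr[OF that(1)] that(2)] union[OF that(1)] by simp
  have prime: "primeideal (?Q P) (R Quot J)" if P: "P \<in> set Ps" for P
  proof (rule primeidealI)
    interpret P: primeideal P R using Ps[OF P] by blast
    show "ideal (?Q P) (R Quot J)" by (rule ring_ideal_imp_quot_ideal[OF J P.is_ideal])
    show "cring (R Quot J)" by (rule J.quotient_is_cring[OF is_cring])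
    show "carrier (R Quot J) \<noteq> ?Q P"
    proof
      assume eq: "carrier (R Quot J) = ?Q P"
      have "x \<in> P" if "x \<in> carrier R" for x
        using h.hom_closed[OF that] mem[OF P that] eq by simp
      then show False using P.I_notcarr P.Icarr by blast
    qed
    fix a b assume ab: "a \<in> carrier (R Quot J)" "b \<in> carrier (R Quot J)"
      "a \<otimes>\<^bsub>R Quot J\<^esub> b \<in> ?Q P"
    then obtain x y where xy: "x \<in> carrier R" "a = J +> x" "y \<in> carrier R" "b = J +> y"
      unfolding FactRing_def A_RCOSETS_def' by auto
    then have "J +> (x \<otimes> y) \<in> ?Q P" using ab(3) by simp
    then have "x \<otimes> y \<in> P" using mem[OF P, of "x \<otimes> y"] xy by simp
    then show "a \<in> ?Q P \<or> b \<in> ?Q P" using P.I_prime xy by blast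
  qed
  have strict: "?Q P \<subset> ?Q P'" if "P \<in> set Ps" "P' \<in> set Ps" "P \<subset> P'" for P P'
    using that union[OF that(1)] union[OF that(2)] by (metis image_mono psubset_eq)
  have "sorted_wrt (\<subset>) (map ?Q Ps)"
    unfolding sorted_wrt_map by (rule sorted_wrt_mono_rel[OF _ chain]) (rule strict)
  moreover have "\<forall>Q\<in>set (map ?Q Ps). primeideal Q (R Quot J)" using prime by auto
  moreover have "map ?Q Ps \<noteq> []" using ne by simp
  ultimately show ?thesis
    unfolding krull_dim_def
    by (intro Sup_upper CollectI exI[of _ "map ?Q Ps"]) (simp only: length_map simp_thms)
qed

text \<open>The map \<open>x\<^sup>a t\<^sup>k \<mapsto> y\<^sup>a\<close> on the terms of least possible degree \<open>|a| = 2 k\<close>, followed by \<open>y\<^sub>v \<mapsto> 1\<close> for \<open>v\<close> outside \<open>U\<close>;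
  terms of larger degree go to \<open>0\<close>. On the Rees ring it is a ring homomorphism that vanishes on the
  graded maximal ideal of \<open>S\<close>.\<close>

definition fibre_eval ::
    "'n :: finite set \<Rightarrow> ('n, 'k :: field) mpoly poly \<Rightarrow> (nat \<Rightarrow>\<^sub>0 nat) \<Rightarrow>\<^sub>0 'k" where
  "fibre_eval U p =
     (\<Sum>k\<le>Polynomial.degree p. init_form (restrict_exp U) (weight UNIV) (2 * k) (poly.coeff p k))"

lemma fibre_eval_superset:
  assumes "Polynomial.degree p \<le> N"
  shows "fibre_eval U p =
     (\<Sum>k\<le>N. init_form (restrict_exp U) (weight UNIV) (2 * k) (poly.coeff p k))"
  unfolding fibre_eval_def using assms
  by (intro sum.mono_neutral_left) (auto simp: coeff_eq_0)

lemma fibre_eval_add: "fibre_eval U (p + q) = fibre_eval U p + fibre_eval U q"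
proof -
  let ?N = "max (Polynomial.degree p) (Polynomial.degree q)"
  have "Polynomial.degree p \<le> ?N" "Polynomial.degree q \<le> ?N" "Polynomial.degree (p + q) \<le> ?N"
    by (auto simp: degree_add_le_max)
  note this[THEN fibre_eval_superset, of U]
  then show ?thesis by (simp add: init_form_add sum.distrib)
qed

lemma fibre_eval_monom:
  "fibre_eval U (monom f k) = init_form (restrict_exp U) (weight UNIV) (2 * k) f"
proof -
  have "fibre_eval U (monom f k) =
      (\<Sum>i\<le>k. init_form (restrict_exp U) (weight UNIV) (2 * i) (poly.coeff (monom f k) i))"
    by (rule fibre_eval_superset) (rule degree_monom_le)
  also have "\<dots> = (\<Sum>i\<le>k. if k = i then init_form (restrict_exp U) (weight UNIV) (2 * k) f else 0)"
    by (intro sum.cong) auto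
  finally show ?thesis by simp
qed

text \<open>The coefficient of \<open>t\<^sup>k\<close> in an element of the Rees ring has order at least \<open>2 k\<close>, so the parts of degree
  \<open>2 k\<close> are initial forms in the sense of \<open>init_form_mult\<close>.\<close>

lemma fibre_eval_mult:
  assumes p: "\<And>k. poly.coeff p k \<in> mono_ideal (edge_sums E k)"
    and q: "\<And>k. poly.coeff q k \<in> mono_ideal (edge_sums E k)"
  shows "fibre_eval U (p * q) = fibre_eval U p * fibre_eval U q"
proof -
  let ?in = "\<lambda>k. init_form (restrict_exp U) (weight UNIV) (2 * k)"
  \<comment> \<open>the same map with values in polynomials in \<open>t\<close>, where products can be compared coefficientwise\<close>
  define T where "T p = (\<Sum>k\<le>Polynomial.degree p. monom (?in k (poly.coeff p k)) k)"
    for p :: "('a, 'b) mpoly poly"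
  have eval: "fibre_eval U p = poly (T p) 1" for p :: "('a, 'b) mpoly poly"
    by (simp add: T_def poly_sum poly_monom fibre_eval_def)
  have coeff: "poly.coeff (T p) k = ?in k (poly.coeff p k)" for k and p :: "('a, 'b) mpoly poly"
    by (auto simp: T_def coeff_sum coeff_eq_0)
  have order: "2 * k \<le> weight UNIV a" if "a \<in> Poly_Mapping.keys f" "f \<in> mono_ideal (edge_sums E k)"
    for a k and f :: "('a, 'b) mpoly"
    using that degree_edge_sums[of _ E k] by (fastforce simp: mono_ideal_def weight_add)
  have "T (p * q) = T p * T q"
  proof (rule poly_eqI)
    fix k
    have "poly.coeff (T (p * q)) k = (\<Sum>i\<le>k. ?in k (poly.coeff p i * poly.coeff q (k - i)))"
      by (simp add: coeff coeff_mult init_form_sum)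
    also have "\<dots> = (\<Sum>i\<le>k. ?in i (poly.coeff p i) * ?in (k - i) (poly.coeff q (k - i)))"
    proof (intro sum.cong refl)
      fix i assume "i \<in> {..k}"
      then have k: "2 * k = 2 * i + 2 * (k - i)" by simp
      show "?in k (poly.coeff p i * poly.coeff q (k - i)) =
          ?in i (poly.coeff p i) * ?in (k - i) (poly.coeff q (k - i))"
        unfolding k
        by (rule init_form_mult) (auto simp: restrict_exp_add weight_add intro: order p q)
    qed
    finally show "poly.coeff (T (p * q)) k = poly.coeff (T p * T q) k"
      by (simp add: coeff coeff_mult)
  qed
  then show ?thesis by (simp add: eval)
qed

text \<open>Evaluating the variables outside the smaller set \<open>U'\<close> factors through evaluating those outside
  \<open>U\<close>.\<close>

lemma fibre_eval_restrict:
  assumes "U' \<subseteq> U" and 0: "fibre_eval U p = 0"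
  shows "fibre_eval U' p = 0"
proof -
  \<comment> \<open>a section of the restriction to \<open>U\<close>, followed by the restriction to the smaller set\<close>
  define \<pi> where "\<pi> x = restrict_exp U' (SOME a. restrict_exp U a = x)" for x
  have \<pi>: "\<pi> (restrict_exp U a) = restrict_exp U' a" for a
  proof -
    have "restrict_exp U (SOME b. restrict_exp U b = restrict_exp U a) = restrict_exp U a"
      by (rule someI[of _ a]) simp
    then show ?thesis using assms(1) unfolding \<pi>_def restrict_exp_eq_iff by blast
  qed
  have "init_form (restrict_exp U') (weight UNIV) k f =
      init_form \<pi> (\<lambda>_. 0) 0 (init_form (restrict_exp U) (weight UNIV) k f)" for k and f :: "('a, 'b) mpoly"
    unfolding init_form_def[of "restrict_exp U"] init_form_sum
    unfolding init_form_def[of "restrict_exp U'"]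
    by (intro sum.cong) (auto simp: init_form_single \<pi>)
  then have "fibre_eval U' p = init_form \<pi> (\<lambda>_. 0) 0 (fibre_eval U p)"
    by (simp add: fibre_eval_def init_form_sum)
  then show ?thesis by (simp add: 0)
qed

lemma carrier_rees_ring_edge_ideal:
  "carrier (rees_ring (edge_ideal E :: ('n, 'k :: field) mpoly set)) =
     {p. \<forall>k. poly.coeff p k \<in> mono_ideal (edge_sums E k)}"
  by (simp add: rees_ring_def edge_ideal_pow)

lemma rees_ring_sel [simp]:
  "x \<otimes>\<^bsub>rees_ring I\<^esub> y = x * y" "x \<oplus>\<^bsub>rees_ring I\<^esub> y = x + y"
  "\<zero>\<^bsub>rees_ring I\<^esub> = 0" "\<one>\<^bsub>rees_ring I\<^esub> = 1"
  by (simp_all add: rees_ring_def ring_of_type_algebra_def)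

definition fibre_prime :: "'n :: finite set set \<Rightarrow> 'n set \<Rightarrow> ('n, 'k :: field) mpoly poly set" where
  "fibre_prime E U = {p \<in> carrier (rees_ring (edge_ideal E)). fibre_eval U p = 0}"

lemma primeideal_fibre_prime:
  "primeideal (fibre_prime E U :: ('n :: finite, 'k :: field) mpoly poly set) (rees_ring (edge_ideal E))"
proof -
  let ?R = "rees_ring (edge_ideal E) :: ('n, 'k) mpoly poly ring"
  let ?D = "ring_of_type_algebra :: ((nat \<Rightarrow>\<^sub>0 nat) \<Rightarrow>\<^sub>0 'k) ring"
  interpret R: cring ?R by (rule rees_ring_is_cring[OF edge_ideal_ideal])
  interpret D: domain ?D by (rule domain_ring_of_type_algebra)
  have "fibre_eval U \<in> ring_hom ?R ?D"
  proof (rule ring_hom_memI)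
    fix x y assume xy: "x \<in> carrier ?R" "y \<in> carrier ?R"
    then show "fibre_eval U (x \<otimes>\<^bsub>?R\<^esub> y) = fibre_eval U x \<otimes>\<^bsub>?D\<^esub> fibre_eval U y"
      using fibre_eval_mult[of x E y U] by (simp add: carrier_rees_ring_edge_ideal)
    show "fibre_eval U (x \<oplus>\<^bsub>?R\<^esub> y) = fibre_eval U x \<oplus>\<^bsub>?D\<^esub> fibre_eval U y"
      by (simp add: fibre_eval_add)
  next
    have "fibre_eval U (monom (Poly_Mapping.single 0 1) 0) = (Poly_Mapping.single 0 1 :: _ \<Rightarrow>\<^sub>0 'k)"
      by (simp only: fibre_eval_monom init_form_single) simp
    then show "fibre_eval U \<one>\<^bsub>?R\<^esub> = \<one>\<^bsub>?D\<^esub>"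
      by (simp add: single_one[symmetric] monom_eq_1 del: single_one) (simp add: monom_eq_1)
  qed simp
  then interpret ring_hom_ring ?R ?D "fibre_eval U"
    by (intro ring_hom_ringI2 R.ring_axioms D.ring_axioms)
  show ?thesis
    using primeideal_vimage[OF R.is_cring D.zeroprimeideal] by (simp add: fibre_prime_def)
qed

lemma fibre_prime_contains:
  assumes "a \<in> graded_max_ideal"
  shows "[:a:] \<in> fibre_prime E U"
proof -
  have "poly.coeff [:a:] k \<in> mono_ideal (edge_sums E k)" for k
    by (cases k) (auto simp: mono_ideal_def simp del: edge_sums.simps(2))
  moreover have "fibre_eval U [:a:] = 0"
  proof -
    have nz: "weight UNIV e \<noteq> 0" if "e \<in> Poly_Mapping.keys a" for e
    proof
      assume "weight UNIV e = 0"
      then have "e = 0" by (intro poly_mapping_eqI) (simp add: weight_def)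
      with that assms show False by (simp add: graded_max_ideal_iff in_keys_iff)
    qed
    have "init_form (restrict_exp U) (weight UNIV) 0 a = 0"
      unfolding init_form_def by (intro sum.neutral ballI) (simp add: nz)
    then show ?thesis by (simp add: fibre_eval_def)
  qed
  ultimately show ?thesis by (simp add: fibre_prime_def carrier_rees_ring_edge_ideal)
qed

text \<open>Writing \<open>\<tau>\<close> for the variable of the Rees ring, the binomial \<open>x\<^sup>s \<tau>\<^sup>j - x\<^sup>t \<tau>\<^sup>k\<close> is killed once \<open>x\<^sub>v\<close> is
  set to \<open>1\<close>, but not before.\<close>

lemma fibre_prime_strict:
  fixes E :: "'n :: finite set set"
  assumes v: "v \<in> U" and s: "s \<in> edge_sums E j" and t: "t \<in> edge_sums E k"
    and agree: "\<And>u. u \<in> U - {v} \<Longrightarrow> Poly_Mapping.lookup s u = Poly_Mapping.lookup t u"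
    and differ: "Poly_Mapping.lookup s v \<noteq> Poly_Mapping.lookup t v"
  shows "(fibre_prime E U :: ('n, 'k :: field) mpoly poly set) \<subset> fibre_prime E (U - {v})"
proof
  show "(fibre_prime E U :: ('n, 'k) mpoly poly set) \<subseteq> fibre_prime E (U - {v})"
    using fibre_eval_restrict[of "U - {v}" U] by (auto simp: fibre_prime_def)
  define z :: "('n, 'k) mpoly poly" where
    "z = monom (Poly_Mapping.single s 1) j + monom (Poly_Mapping.single t (- 1)) k"
  have "poly.coeff z i \<in> mono_ideal (edge_sums E i)" for i
    unfolding z_def coeff_add
    by (intro ideal_add[OF mono_ideal_ideal])
      (use s t mono_ideal_single[of s "edge_sums E j" 0] mono_ideal_single[of t "edge_sums E k" 0] in
        \<open>auto simp: ideal_zero[OF mono_ideal_ideal]\<close>)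
  then have carr: "z \<in> carrier (rees_ring (edge_ideal E))"
    by (simp add: carrier_rees_ring_edge_ideal)
  have eval: "fibre_eval W z =
      Poly_Mapping.single (restrict_exp W s) 1 + Poly_Mapping.single (restrict_exp W t) (- 1)" for W
    using degree_edge_sums[OF s] degree_edge_sums[OF t]
    by (simp add: z_def fibre_eval_add fibre_eval_monom init_form_single)
  have "restrict_exp (U - {v}) s = restrict_exp (U - {v}) t"
    using agree by (simp add: restrict_exp_eq_iff)
  then have "z \<in> fibre_prime E (U - {v})"
    using carr by (simp add: fibre_prime_def eval single_add[symmetric])
  moreover have "z \<notin> fibre_prime E U"
  proof -
    have "restrict_exp U s \<noteq> restrict_exp U t"
      using v differ by (auto simp: restrict_exp_eq_iff)
    then have "Poly_Mapping.lookup (fibre_eval U z) (restrict_exp U s) = 1"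
      by (simp add: eval lookup_add lookup_single when_def)
    then show ?thesis by (auto simp: fibre_prime_def)
  qed
  ultimately show "(fibre_prime E U :: ('n, 'k) mpoly poly set) \<noteq> fibre_prime E (U - {v})" by blast
qed

text \<open>The primes obtained by removing the vertices of \<open>U\<close> one at a time form a chain of length \<open>card U\<close>.\<close>

lemma analytic_spread_edge_ideal_ge:
  fixes E :: "'n :: finite set set"
  assumes sep: "\<And>v. v \<in> U \<Longrightarrow> \<exists>j k. \<exists>s\<in>edge_sums E j. \<exists>t\<in>edge_sums E k.
      (\<forall>u\<in>U - {v}. Poly_Mapping.lookup s u = Poly_Mapping.lookup t u) \<and>
      Poly_Mapping.lookup s v \<noteq> Poly_Mapping.lookup t v"
  shows "enat (card U) \<le> analytic_spread graded_max_ideal (edge_ideal E :: ('n, 'k :: field) mpoly set)"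
proof -
  let ?R = "rees_ring (edge_ideal E) :: ('n, 'k) mpoly poly ring"
  let ?m = "(\<lambda>a. [:a:]) ` (graded_max_ideal :: ('n, 'k) mpoly set)"
  interpret R: cring ?R by (rule rees_ring_is_cring[OF edge_ideal_ideal])
  have chain: "\<exists>Ps. length Ps = Suc (card W) \<and> sorted_wrt (\<subset>) Ps \<and>
      (\<forall>P\<in>set Ps. fibre_prime E W \<subseteq> P \<and> (\<exists>V. P = (fibre_prime E V :: ('n, 'k) mpoly poly set)))"
    if "finite W" "W \<subseteq> U" for W
    using that
  proof (induction W rule: finite_remove_induct)
    case empty
    show ?case by (intro exI[of _ "[fibre_prime E {}]"]) auto
  next
    case (remove W)
    obtain v where v: "v \<in> W" using remove by blast
    obtain Ps where Ps: "length Ps = Suc (card (W - {v}))" "sorted_wrt (\<subset>) Ps"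
      "\<forall>P\<in>set Ps. fibre_prime E (W - {v}) \<subseteq> P \<and>
        (\<exists>V. P = (fibre_prime E V :: ('n, 'k) mpoly poly set))"
      using remove.IH[OF v] remove.prems by blast
    obtain j k s t where st: "s \<in> edge_sums E j" "t \<in> edge_sums E k"
      "\<forall>u\<in>U - {v}. Poly_Mapping.lookup s u = Poly_Mapping.lookup t u"
      "Poly_Mapping.lookup s v \<noteq> Poly_Mapping.lookup t v"
      using sep[of v] v remove.prems by blast
    have sub: "(fibre_prime E W :: ('n, 'k) mpoly poly set) \<subset> fibre_prime E (W - {v})"
      using st(3) remove.prems by (intro fibre_prime_strict[OF v st(1,2) _ st(4)]) blast
    have above: "fibre_prime E W \<subset> P" if "P \<in> set Ps" for P
      using Ps(3) that sub by (meson psubset_subset_trans)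
    have "length (fibre_prime E W # Ps) = Suc (card W)"
      using Ps(1) card_Suc_Diff1[of W v] v remove.hyps by simp
    moreover have "sorted_wrt (\<subset>) (fibre_prime E W # Ps)"
      using Ps(2) above by simp
    moreover have "\<forall>P\<in>set (fibre_prime E W # Ps). fibre_prime E W \<subseteq> P \<and>
        (\<exists>V. P = (fibre_prime E V :: ('n, 'k) mpoly poly set))"
      using Ps(3) above[THEN psubset_imp_subset] by auto
    ultimately show ?case by blast
  qed
  obtain Ps where Ps: "length Ps = Suc (card U)" "sorted_wrt (\<subset>) Ps"
    "\<forall>P\<in>set Ps. \<exists>V. P = (fibre_prime E V :: ('n, 'k) mpoly poly set)"
    using chain[of U] by auto
  have sub: "?m \<subseteq> carrier ?R"
    using fibre_prime_contains[of _ E UNIV] by (auto simp: fibre_prime_def)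
  have "enat (length Ps - 1) \<le> krull_dim (?R Quot (Idl\<^bsub>?R\<^esub> ?m))"
  proof (rule krull_dim_quotient_ge[OF R.is_cring R.genideal_ideal[OF sub] _ _ Ps(2)])
    show "Ps \<noteq> []" using Ps(1) by auto
    fix P assume "P \<in> set Ps"
    then obtain V where P: "P = fibre_prime E V" using Ps(3) by blast
    interpret P: primeideal P ?R unfolding P by (rule primeideal_fibre_prime)
    have "Idl\<^bsub>?R\<^esub> ?m \<subseteq> P"
      by (rule R.genideal_minimal[OF P.is_ideal]) (auto simp: P fibre_prime_contains)
    then show "primeideal P ?R \<and> Idl\<^bsub>?R\<^esub> ?m \<subseteq> P"
      using P.primeideal by blast
  qed
  then show ?thesis by (simp add: analytic_spread_def Ps(1))
qed

section \<open>Stability index against analytic spread\<close>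

lemma card_ge_3_of_two_edges:
  fixes E :: "'n :: finite set set"
  assumes "simple_graph E" "card E \<ge> 2"
  shows "CARD('n) \<ge> 3"
proof (rule ccontr)
  assume "\<not> ?thesis"
  then have small: "CARD('n) \<le> 2" by simp
  have "e = UNIV" if "e \<in> E" for e
    using assms(1) that small card_seteq[of UNIV e] by (auto simp: simple_graph_def)
  then have "E \<subseteq> {UNIV}" by blast
  then have "card E \<le> 1" using card_mono[of "{UNIV}" E] by simp
  with assms(2) show False by simp
qed

lemma dstab_le:
  assumes "1 \<le> k" "\<And>l. k \<le> l \<Longrightarrow> depth R \<mm> (quot_module R (ideal_pow R I l)) = d"
  shows "dstab R \<mm> I \<le> enat k"
  unfolding dstab_def by (rule Inf_lower) (use assms in auto)

text \<open>To separate coordinates, all variables except one \<open>x\<^sub>b\<close> are used. For \<open>v\<close> in \<open>A\<close> the sums of edges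
  \<open>c + e\<^sub>v + e\<^sub>b\<close> and \<open>c\<close> differ, apart from \<open>b\<close>, in \<open>v\<close> only; for \<open>v\<close> outside \<open>A\<close> one takes
  \<open>c + e\<^sub>a + e\<^sub>v\<close> and \<open>c + e\<^sub>a + e\<^sub>b\<close>.\<close>

lemma bipartite_bounds:
  fixes E :: "'n :: finite set set"
  assumes n: "CARD('n) \<ge> 3" and bal: "bicoloured_exchange E UNIV A c (CARD('n) - 3)" and A: "crosses E A"
  defines "I \<equiv> edge_ideal E :: ('n, 'k :: field) mpoly set"
  shows "dstab mpoly_ring graded_max_ideal I \<le> enat (CARD('n) - 2)"
    and "enat (CARD('n) - 1) \<le> analytic_spread graded_max_ideal I"
proof -
  let ?k = "CARD('n) - 3"
  have c: "c \<in> edge_sums E ?k"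
    and mixed: "\<And>a b. a \<in> A \<Longrightarrow> b \<notin> A \<Longrightarrow> c + vtx a + vtx b \<in> edge_sums E (Suc ?k)"
    using bal by (auto simp: bicoloured_exchange_def simp del: edge_sums.simps)
  obtain w w' where w: "{w, w'} \<in> E" "w \<in> A \<longleftrightarrow> w' \<notin> A"
    using bicoloured_exchange_neighbour[OF bal UNIV_I] by blast
  obtain a b where a: "a \<in> A" and b: "b \<notin> A" using w(2) by blast
  show "dstab mpoly_ring graded_max_ideal I \<le> enat (CARD('n) - 2)"
  proof (rule dstab_le)
    show "1 \<le> CARD('n) - 2" using n by simp
    fix l assume l: "CARD('n) - 2 \<le> l"
    then have l': "l = Suc (?k + (l - (CARD('n) - 2)))" using n by simp
    obtain t where t: "t \<in> edge_sums E (l - (CARD('n) - 2))"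
      using edge_sums_nonempty[OF w(1)] by blast
    have "c + t \<in> edge_sums E (?k + (l - (CARD('n) - 2)))"
      by (rule edge_sums_add[OF c t])
    moreover have "c + t + vtx a + vtx b \<in> edge_sums E (Suc (?k + (l - (CARD('n) - 2))))"
      if "a \<in> A" "b \<notin> A" for a b
      using edge_sums_add[OF mixed[OF that] t] by (simp only: add_ac add_Suc)
    ultimately show "depth mpoly_ring graded_max_ideal (quot_module mpoly_ring (ideal_pow mpoly_ring I l)) = 1"
      unfolding I_def by (subst l') (rule depth_bipartite_power[OF A a b])
  qed
  have "enat (card (UNIV - {b})) \<le> analytic_spread graded_max_ideal I"
    unfolding I_def
  proof (rule analytic_spread_edge_ideal_ge)
    fix v assume v: "v \<in> UNIV - {b}"
    show "\<exists>j k. \<exists>s\<in>edge_sums E j. \<exists>t\<in>edge_sums E k.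
      (\<forall>u\<in>UNIV - {b} - {v}. Poly_Mapping.lookup s u = Poly_Mapping.lookup t u) \<and>
      Poly_Mapping.lookup s v \<noteq> Poly_Mapping.lookup t v"
    proof (cases "v \<in> A")
      case True
      show ?thesis
        by (rule exI, rule exI, rule bexI[OF bexI[OF _ c] mixed[OF True b]])
          (use v in \<open>auto simp: lookup_add lookup_vtx\<close>)
    next
      case False
      show ?thesis
        by (rule exI, rule exI, rule bexI[OF bexI[OF _ mixed[OF a b]] mixed[OF a False]])
          (use v in \<open>auto simp: lookup_add lookup_vtx\<close>)
    qed
  qed
  then show "enat (CARD('n) - 1) \<le> analytic_spread graded_max_ideal I"
    by (simp add: card_Diff_singleton)
qed

text \<open>Here all \<open>n\<close> coordinates can be separated: for an edge from \<open>u\<close> to \<open>y\<close> the sums of edges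
  \<open>2 (f + e\<^sub>v) + (e\<^sub>u + e\<^sub>y)\<close> and \<open>(f + e\<^sub>u) + (f + e\<^sub>y)\<close> differ by \<open>2 e\<^sub>v\<close>.\<close>

lemma nonbipartite_bounds:
  fixes E :: "'n :: finite set set"
  assumes n: "CARD('n) \<ge> 3" and bal: "bicoloured_exchange E UNIV A c (CARD('n) - 3)" and odd: "\<not> crosses E A"
  defines "I \<equiv> edge_ideal E :: ('n, 'k :: field) mpoly set"
  shows "dstab mpoly_ring graded_max_ideal I \<le> enat (CARD('n) - 1)"
    and "enat CARD('n) \<le> analytic_spread graded_max_ideal I"
proof -
  let ?k = "CARD('n) - 3 + 2"
  obtain f where f: "weight UNIV f = 2 * (CARD('n) - 3) + 3" "\<And>v. f + vtx v \<in> edge_sums E ?k"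
    using nonbipartite_socle_exponent[OF bal odd] by blast
  obtain u y where uy: "{u, y} \<in> E"
    using bicoloured_exchange_neighbour[OF bal UNIV_I] by blast
  show "dstab mpoly_ring graded_max_ideal I \<le> enat (CARD('n) - 1)"
  proof (rule dstab_le)
    show "1 \<le> CARD('n) - 1" using n by simp
    fix l assume l: "CARD('n) - 1 \<le> l"
    let ?j = "l - (CARD('n) - 1)"
    have l': "?k + ?j = l" using l n by simp
    obtain t where t: "t \<in> edge_sums E ?j"
      using edge_sums_nonempty[OF uy] by blast
    have "weight UNIV (f + t) + 1 = 2 * l"
      using f(1) degree_edge_sums[OF t] l n by (simp add: weight_add)
    moreover have "f + t + vtx v \<in> edge_sums E l" for v
      using edge_sums_add[OF f(2)[of v] t] unfolding l' by (simp only: add_ac)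
    ultimately show "depth mpoly_ring graded_max_ideal (quot_module mpoly_ring (ideal_pow mpoly_ring I l)) = 0"
      unfolding I_def by (rule depth_nonbipartite_power)
  qed
  have "enat (card (UNIV :: 'n set)) \<le> analytic_spread graded_max_ideal I"
    unfolding I_def
  proof (rule analytic_spread_edge_ideal_ge)
    fix v :: 'n
    have s: "f + vtx v + (f + vtx v) + (vtx u + vtx y) \<in> edge_sums E (Suc (?k + ?k))"
      by (intro edge_sums_edge uy edge_sums_add f(2))
    have t: "f + vtx u + (f + vtx y) \<in> edge_sums E (?k + ?k)"
      by (intro edge_sums_add f(2))
    show "\<exists>j k. \<exists>s\<in>edge_sums E j. \<exists>t\<in>edge_sums E k.
      (\<forall>u\<in>UNIV - {v}. Poly_Mapping.lookup s u = Poly_Mapping.lookup t u) \<and>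
      Poly_Mapping.lookup s v \<noteq> Poly_Mapping.lookup t v"
      by (rule exI, rule exI, rule bexI[OF bexI[OF _ t] s])
        (auto simp: lookup_add lookup_vtx)
  qed
  then show "enat CARD('n) \<le> analytic_spread graded_max_ideal I" .
qed

theorem theorem1p2:
  fixes E :: "'n :: finite set set"
    and I :: "('n, 'k :: field) mpoly set"
  assumes "simple_graph E" and "connected_graph E" and "card E \<ge> 2"
    and "I = edge_ideal E"
  shows "dstab mpoly_ring graded_max_ideal I < analytic_spread graded_max_ideal I \<and>
         dstab mpoly_ring graded_max_ideal I < enat CARD('n)"
proof -
  have n: "CARD('n) \<ge> 3" by (rule card_ge_3_of_two_edges[OF assms(1,3)])
  obtain A c where bal: "bicoloured_exchange E UNIV A c (CARD('n) - 3)"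
    using bicoloured_exchange_spanning[OF assms(2) n] by blast
  show ?thesis
  proof (cases "crosses E A")
    case True
    have "enat (CARD('n) - 2) < enat (CARD('n) - 1)" "enat (CARD('n) - 2) < enat CARD('n)"
      using n by auto
    with bipartite_bounds[OF n bal True, where ?'k = 'k] show ?thesis
      unfolding assms(4) by (meson order.strict_trans1 order.strict_trans2)
  next
    case False
    have "enat (CARD('n) - 1) < enat CARD('n)" using n by auto
    with nonbipartite_bounds[OF n bal False, where ?'k = 'k] show ?thesis
      unfolding assms(4) by (meson order.strict_trans1 order.strict_trans2)
  qed
qed

end
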